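(* Keep the per-unit information fixed and let $n\to\infty$. Let $G^\star$ be a fixed probability measure on $\mathcal V$ with $\nu_i\overset{iid}{\sim}G^\star$, and let the primary parameters $\theta^\star=\theta^\star_n$ be fixed for each $n$ (empirical Bayes frame). Suppose Assumptions 1, 2, 3 and 4 hold and that $$\mathbb E_{G^\star}\big[\mathfrak D_{\mathrm{BL}}\big(G_\Pi[U_1,\dots,U_n],G^\star\big)\big]\to0\quad\text{as }n\to\infty.$$ Then $$\limsup_{n\to\infty}\sup_{\alpha\in[0,1]}\max_{i\in\mathcal H_0}\big|\mathbb P_{G^\star,\theta^\star}(P_i\le\alpha)-\alpha\big|=0.$$
   Context: Setup: for units $i=1,\dots,n$, the data of unit $i$ are summarized by a test statistic $T_i\in\mathbb R$ and a nuisance parameter statistic $U_i\in\mathcal U$. Unit $i$ has a primary parameter $\theta_i$ and a nuisance parameter $\nu_i\in\mathcal V$. Conditionally on parameters, the pairs $(T_i,U_i)$ are independent across $i$, the law of $(T_i,U_i)$ depends only on $(\theta_i,\nu_i)$ (the same conditional law for every $i$ and $n$), and the law of $U_i$ depends only on $\nu_i$. The hierarchical model used for inference posits $\nu_i\mid G$ i.i.d. $G$, $G\sim\Pi$, for a fixed prior $\Pi$ on probability measures on $\mathcal V$. A null value $\theta_0$ is fixed, $\mathcal H_0=\{i:\theta_i^\star=\theta_0\}$. Partially Bayes p-value: $P_i:=\mathfrak P_i(T_i,(U_1,\dots,U_n);\Pi)$ with $\mathfrak P_i(t,(u_1,\dots,u_n);\Pi):=\mathbb P_\Pi(|T_i|\ge|t|\mid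 U_1=u_1,\dots,U_n=u_n)$ under the joint hierarchical law with $\theta_i=\theta_0$. Oracle p-value function: $P^{\mathrm{or}}(t,u,\nu):=\mathbb P(|T_i|\ge|t|\mid U_i=u,\nu_i=\nu)$ under $\theta_i=\theta_0$. Posterior mean: $G_\Pi[u_1,\dots,u_m](A):=\mathbb E_\Pi[G(A)\mid U_1=u_1,\dots,U_m=u_m]$. Bounded Lipschitz metric on probability measures on $\mathcal V$: $\mathfrak D_{\mathrm{BL}}(G,G'):=\sup\{|\int\psi\,dG-\int\psi\,dG'|:\|\psi\|_\infty\le1,\ \psi\text{ 1-Lipschitz}\}$. $\mathbb P_{G^\star,\theta^\star}$, $\mathbb E_{G^\star}$: probability/expectation with $\theta^\star$ fixed, $\nu_i$ i.i.d. $G^\star$, data drawn given parameters. Assumption 1: for all $\nu,u$, the conditional law of $T_i$ given $\nu_i=\nu,U_i=u$ (under $\theta_i=\theta_0$) is absolutely continuous w.r.t. Lebesgue measure. Assumption 2: $\mathcal V$ is a compact metric space with metric $d$. Assumption 3: the family of functions $\nu\mapsto P^{\mathrm{or}}(t,u,\nu)$, indexed by $t\in\mathbb R$, $u\in\mathcal U$, is uniformly equicontinuous on $\mathcal V$. Assumption 4: the family $\{\mathbb P(U_i\in\cdot\mid\nu_i=\nu):\nu\in\mathcal V\}$ is tight ($\mathcal U$ a topological space: for each $\varepsilon>0$ there is a compact $C\subset\mathcal U$ with $\mathbb P(U_i\notin C\mid\nu_i=\nu)<\varepsilon$ for all $\nu$); all these laws are absolutely continuous w.r.t. a measure $\lambda$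 on $\mathcal U$ with densities $p(u\mid\nu)$; and for every compact $C\subset\mathcal U$, $\lambda(C)<\infty$ and the functions $\{\nu\mapsto p(u\mid\nu):u\in C\}$ are uniformly bounded and equicontinuous. *)

theory Defs
  imports "HOL-Probability.Probability"
begin

definition TU_space :: "(real \<times> 'u::topological_space) measure" where
  "TU_space = (borel :: real measure) \<Otimes>\<^sub>M (borel :: 'u measure)"

text \<open>Oracle p-value function, from the conditional law Q nu u of T_i given
  U_i = u, nu_i = nu (under theta_i = theta_0).\<close>
definition Por :: "('v \<Rightarrow> 'u \<Rightarrow> real measure) \<Rightarrow> real \<Rightarrow> 'u \<Rightarrow> 'v \<Rightarrow> real" where
  "Por Q t u \<nu> = measure (Q \<nu> u) {s. \<bar>s\<bar> \<ge> \<bar>t\<bar>}"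

definition marg_dens :: "('u \<Rightarrow> 'v \<Rightarrow> real) \<Rightarrow> 'v measure \<Rightarrow> 'u \<Rightarrow> real" where
  "marg_dens p G u = (\<integral>\<nu>. p u \<nu> \<partial>G)"

definition lik :: "('u \<Rightarrow> 'v \<Rightarrow> real) \<Rightarrow> 'v measure \<Rightarrow> (nat \<Rightarrow> 'u) \<Rightarrow> nat \<Rightarrow> real" where
  "lik p G us m = (\<Prod>j<m. marg_dens p G (us j))"

text \<open>Partially Bayes p-value P_Pi(|T_i| >= |t| | U_1 = u_1, ..., U_n = u_n) under the
  hierarchical model G ~ Prior, nu_j iid G, theta_i = theta_0, via Bayes' formula with densities.\<close>
definition pb_pval :: "'v measure measure \<Rightarrow> ('u \<Rightarrow> 'v \<Rightarrow> real) \<Rightarrow> ('v \<Rightarrow> 'u \<Rightarrow> real measure)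
    \<Rightarrow> nat \<Rightarrow> nat \<Rightarrow> real \<Rightarrow> (nat \<Rightarrow> 'u) \<Rightarrow> real" where
  "pb_pval Prior p Q n i t us =
     (\<integral>G. (\<integral>\<nu>. Por Q t (us i) \<nu> * p (us i) \<nu> \<partial>G) * (\<Prod>j\<in>{..<n} - {i}. marg_dens p G (us j)) \<partial>Prior)
     / (\<integral>G. lik p G us n \<partial>Prior)"

text \<open>Posterior mean G_Pi[u_1..u_m](A) = E_Pi[G(A) | U_1 = u_1, ..., U_m = u_m].\<close>
definition post_mean :: "'v::topological_space measure measure \<Rightarrow> ('u \<Rightarrow> 'v \<Rightarrow> real) \<Rightarrow> (nat \<Rightarrow> 'u) \<Rightarrow> nat \<Rightarrow> 'v measure" where
  "post_mean Prior p us m = measure_of (space (borel :: 'v measure)) (sets (borel :: 'v measure))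
     (\<lambda>A. ennreal ((\<integral>G. measure G A * lik p G us m \<partial>Prior) / (\<integral>G. lik p G us m \<partial>Prior)))"

definition dBL :: "'v::metric_space measure \<Rightarrow> 'v measure \<Rightarrow> real" where
  "dBL M N = Sup {\<bar>(\<integral>x. \<psi> x \<partial>M) - (\<integral>x. \<psi> x \<partial>N)\<bar> | \<psi>.
      (\<forall>x. \<bar>\<psi> x\<bar> \<le> 1) \<and> (\<forall>x y. \<bar>\<psi> x - \<psi> y\<bar> \<le> dist x y)}"

end

theory Submission
  imports Defs
begin

text \<open>
  Conditioning on \<open>U\<^sub>i\<close> last, \<open>P\<^sub>i\<close> equals \<open>F(H; T\<^sub>i, U\<^sub>i)\<close>, where
  \<open>F(G; t, u) = \<integral> Por(t, u, \<nu>) p(u | \<nu>) dG / \<integral> p(u | \<nu>) dG\<close> and \<open>H\<close> is the posterior mean given the other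
  \<open>n - 1\<close> statistics, whose expected distance to \<open>Gs\<close> is the same for every \<open>i\<close> and tends to \<open>0\<close>.
  The oracle \<open>F(Gs; T\<^sub>i, U\<^sub>i)\<close> is exactly uniform, because the laws of \<open>T\<^sub>i\<close> are atomless. Writing \<open>N\<close> for the
  numerator and \<open>m\<close> for the denominator of \<open>F\<close>, the bound \<open>N \<le> m\<close> gives
  \<open>m(Gs) |F(H) - F(Gs)| \<le> |N(H) - N(Gs)| + |m(H) - m(Gs)|\<close>, and on a compact set of values of \<open>u\<close> the right-hand
  side is controlled uniformly by \<open>dBL H Gs\<close>, the integrands being equicontinuous. The values of \<open>u\<close> outside
  a compact set, or with small \<open>m(Gs)\<close> inside it, have small probability.
\<close>

section \<open>Joint measurability and bounded Lipschitz functions\<close>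

text \<open>Peeling off \<open>U_i\<close> is possible because the law of each \<open>U_j\<close> is
  free of its \<open>\<theta>\<close>: whatever the primary parameters are, the other statistics are
  i.i.d. from one mixture, and a single deterministic sequence of risks, read at
  \<open>n - 1\<close>, controls all nulls at once. Most of the work is measurability.
  \<open>Q\<close> is a kernel in \<open>u\<close> for each fixed \<open>\<nu>\<close>, and
  \<open>p\<close> is measurable in \<open>u\<close> for each fixed \<open>\<nu>\<close>; joint
  measurability has to be recovered from continuity in \<open>\<nu>\<close> over a compact space.
  \<open>dBL\<close> is a supremum over an uncountable class and must be reduced to a countable one
  before Markov's inequality makes sense. Fubini's theorem asks for a sigma-finite dominating
  measure, which \<open>lam\<close> is not assumed to be. Vanishing denominators are handled by
  letting quotients be 0 and the posterior mean be the null measure there. With these conventions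
  the identity between \<open>P_i\<close> and the mixture formula holds at every sample point, at
  the price of working with sub-probabilities.\<close>

lemma compact_finite_net:
  assumes "compact (UNIV :: 'v::metric_space set)" "0 < e"
  obtains xs :: "'v::metric_space list" where "\<And>v. \<exists>j<length xs. dist (xs ! j) v < e"
proof -
  obtain C :: "'v set" where C: "finite C" "UNIV \<subseteq> (\<Union>x\<in>C. ball x e)"
    using assms unfolding compact_eq_totally_bounded by blast
  obtain xs where xs: "set xs = C"
    using finite_list[OF C(1)] by blast
  have "\<exists>j<length xs. dist (xs ! j) v < e" for v
  proof -
    have "v \<in> (\<Union>x\<in>C. ball x e)" using C(2) by blast
    then obtain c where "c \<in> C" "dist c v < e"
      by auto
    then show ?thesis
      using xs by (metis in_set_conv_nth)
  qed
  then show ?thesis by (rule that)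
qed

lemma compact_finite_nets:
  assumes "compact (UNIV :: 'v::metric_space set)"
  obtains X :: "nat \<Rightarrow> 'v::metric_space list" where "\<And>k v. \<exists>j<length (X k). dist (X k ! j) v < 1 / Suc k"
proof -
  have "\<exists>xs. \<forall>v::'v. \<exists>j<length xs. dist (xs ! j) v < 1 / Suc k" for k
    using compact_finite_net[OF assms, of "1 / Suc k"]
    by (metis divide_pos_pos of_nat_0_less_iff zero_less_Suc zero_less_one)
  then show ?thesis using that by metis
qed

text \<open>Round \<open>v\<close> to the first point of a \<open>1 / Suc k\<close>-net within that
  distance. The rounding takes countably many values, each on a Borel set, so the rounded
  \<open>f\<close> is measurable piece by piece, and continuity in \<open>v\<close> makes it
  converge to \<open>f\<close> pointwise.\<close>

lemma borel_measurable_Caratheodory: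
  fixes f :: "'a \<Rightarrow> 'v::metric_space \<Rightarrow> real"
  assumes comp: "compact (UNIV :: 'v set)"
    and meas: "\<And>v. (\<lambda>x. f x v) \<in> borel_measurable M"
    and cont: "\<And>x. x \<in> space M \<Longrightarrow> continuous_on UNIV (f x)"
  shows "(\<lambda>(x, v). f x v) \<in> borel_measurable (M \<Otimes>\<^sub>M borel)"
proof -
  obtain X :: "nat \<Rightarrow> 'v list"
    where X: "\<And>k v. \<exists>j<length (X k). dist (X k ! j) v < 1 / Suc k"
    using compact_finite_nets[OF comp] by blast
  define g where "g k v = (LEAST j. dist (X k ! j) v < 1 / Suc k)" for k v
  have [measurable]: "Measurable.pred borel (\<lambda>v. dist (X k ! j) v < 1 / Suc k)" for k j
    using borel_open[OF open_ball[of "X k ! j" "1 / Suc k"]] by (simp add: pred_def ball_def)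
  have g_meas: "g k \<in> borel \<rightarrow>\<^sub>M count_space UNIV" for k
    unfolding g_def by measurable
  have g_dist: "dist (X k ! g k v) v < 1 / Suc k" for k v
    unfolding g_def using X[of k v] by (metis (mono_tags, lifting) LeastI)
  have g_lim: "(\<lambda>k. X k ! g k v) \<longlonglongrightarrow> v" for v
  proof (rule metric_LIMSEQ_I)
    fix r :: real assume "0 < r"
    then obtain k0 where k0: "1 / real (Suc k0) < r"
      using nat_approx_posE by blast
    have "dist (X k ! g k v) v < r" if "k \<ge> k0" for k
    proof -
      have "1 / real (Suc k) \<le> 1 / real (Suc k0)"
        using that by (simp add: frac_le)
      then show ?thesis using g_dist[of k v] k0 by linarith
    qed
    then show "\<exists>no. \<forall>n\<ge>no. dist (X n ! g n v) v < r" by blast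
  qed
  show ?thesis
  proof (rule borel_measurable_LIMSEQ_real)
    fix z assume "z \<in> space (M \<Otimes>\<^sub>M (borel :: 'v measure))"
    then have "fst z \<in> space M" by (auto simp: space_pair_measure)
    from continuous_on_tendsto_compose[OF cont[OF this] g_lim[of "snd z"]]
    show "(\<lambda>k. f (fst z) (X k ! g k (snd z))) \<longlonglongrightarrow> (case z of (x, v) \<Rightarrow> f x v)"
      by (auto simp: case_prod_beta)
  next
    fix k
    show "(\<lambda>z. f (fst z) (X k ! g k (snd z))) \<in> borel_measurable (M \<Otimes>\<^sub>M borel)"
    proof (rule measurable_compose_countable[where g = "\<lambda>z. g k (snd z)"])
      show "(\<lambda>z. f (fst z) (X k ! i)) \<in> borel_measurable (M \<Otimes>\<^sub>M borel)" for i
        using measurable_compose[OF measurable_fst meas] .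
      show "(\<lambda>z. g k (snd z)) \<in> M \<Otimes>\<^sub>M borel \<rightarrow>\<^sub>M count_space UNIV"
        using measurable_compose[OF measurable_snd g_meas] .
    qed
  qed
qed

section \<open>Bounded Lipschitz test functions and the metric \<open>dBL\<close>\<close>

definition bl_ball :: "('v::metric_space \<Rightarrow> real) set" where
  "bl_ball = {\<psi>. (\<forall>x. \<bar>\<psi> x\<bar> \<le> 1) \<and> (\<forall>x y. \<bar>\<psi> x - \<psi> y\<bar> \<le> dist x y)}"

lemma dBL_eq_SUP: "dBL M N = (SUP \<psi>\<in>bl_ball. \<bar>(\<integral>x. \<psi> x \<partial>M) - (\<integral>x. \<psi> x \<partial>N)\<bar>)"
  unfolding dBL_def bl_ball_def by (rule arg_cong[where f = Sup]) auto

lemma bl_ball_zero: "(\<lambda>x. 0) \<in> bl_ball"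
  by (simp add: bl_ball_def)

lemma bl_ball_measurable: "\<psi> \<in> bl_ball \<Longrightarrow> \<psi> \<in> borel_measurable borel"
proof (rule borel_measurable_continuous_onI)
  assume "\<psi> \<in> bl_ball"
  then show "continuous_on UNIV \<psi>"
    unfolding continuous_on_iff bl_ball_def by (auto simp: dist_real_def) (meson le_less_trans)
qed

lemma
  fixes f :: "'a \<Rightarrow> real"
  assumes "subprob_space M" "f \<in> borel_measurable M" "\<And>x. \<bar>f x\<bar> \<le> B"
  shows integrable_subprob_bounded: "integrable M f"
    and abs_integral_subprob_le: "\<bar>\<integral>x. f x \<partial>M\<bar> \<le> B"
proof -
  interpret subprob_space M by fact
  show I: "integrable M f"
    by (rule integrable_const_bound[of _ B]) (use assms in auto)
  have B: "0 \<le> B" using assms(3)[of undefined] by linarith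
  have "\<bar>\<integral>x. f x \<partial>M\<bar> \<le> (\<integral>x. \<bar>f x\<bar> \<partial>M)"
    using integral_abs_bound by blast
  also have "\<dots> \<le> (\<integral>x. B \<partial>M)"
    using I assms by (intro integral_mono) auto
  also have "\<dots> = B * measure M (space M)" by simp
  also have "\<dots> \<le> B * 1"
    using B subprob_measure_le_1 by (intro mult_left_mono) auto
  finally show "\<bar>\<integral>x. f x \<partial>M\<bar> \<le> B" by simp
qed

text \<open>Sub-probabilities are allowed because the posterior mean, which will be compared with
  \<open>Gs\<close>, degenerates to the null measure when the evidence vanishes.\<close>

locale subprob_borel_pair = M: subprob_space M + N: subprob_space N
  for M N :: "'v::metric_space measure" +
  assumes sets_M [measurable_cong]: "sets M = sets borel" and sets_N [measurable_cong]: "sets N = sets borel"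
begin

lemma bl_ball_diff_le: "\<psi> \<in> bl_ball \<Longrightarrow> \<bar>(\<integral>x. \<psi> x \<partial>M) - (\<integral>x. \<psi> x \<partial>N)\<bar> \<le> 2"
  using abs_integral_subprob_le[OF M.subprob_space_axioms, of \<psi> 1]
    abs_integral_subprob_le[OF N.subprob_space_axioms, of \<psi> 1] bl_ball_measurable[of \<psi>]
    measurable_cong_sets[OF sets_M refl] measurable_cong_sets[OF sets_N refl]
  by (fastforce simp: bl_ball_def)

lemma bdd_above_bl_ball: "bdd_above ((\<lambda>\<psi>. \<bar>(\<integral>x. \<psi> x \<partial>M) - (\<integral>x. \<psi> x \<partial>N)\<bar>) ` bl_ball)"
  using bl_ball_diff_le by (intro bdd_aboveI[of _ 2]) auto

lemma bl_ball_le_dBL: "\<psi> \<in> bl_ball \<Longrightarrow> \<bar>(\<integral>x. \<psi> x \<partial>M) - (\<integral>x. \<psi> x \<partial>N)\<bar> \<le> dBL M N"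
  unfolding dBL_eq_SUP by (rule cSUP_upper[OF _ bdd_above_bl_ball])

lemma dBL_nonneg: "0 \<le> dBL M N"
  using bl_ball_le_dBL[OF bl_ball_zero] by simp

lemma dBL_le_2: "dBL M N \<le> 2"
  unfolding dBL_eq_SUP using bl_ball_diff_le bl_ball_zero by (intro cSUP_least) auto

lemma integral_diff_uniform:
  fixes f g :: "'v \<Rightarrow> real"
  assumes [measurable]: "f \<in> borel_measurable borel" "g \<in> borel_measurable borel"
    and "\<And>x. \<bar>f x\<bar> \<le> B" "\<And>x. \<bar>g x\<bar> \<le> B'" and fg: "\<And>x. \<bar>f x - g x\<bar> \<le> e"
  shows "\<bar>(\<integral>x. f x \<partial>M) - (\<integral>x. f x \<partial>N)\<bar> \<le> \<bar>(\<integral>x. g x \<partial>M) - (\<integral>x. g x \<partial>N)\<bar> + 2 * e"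
proof -
  have I: "integrable M f" "integrable M g" "integrable N f" "integrable N g"
    by (rule integrable_subprob_bounded[OF _ _ assms(3)] integrable_subprob_bounded[OF _ _ assms(4)],
        rule M.subprob_space_axioms N.subprob_space_axioms, measurable)+
  have "\<bar>\<integral>x. f x - g x \<partial>M\<bar> \<le> e" "\<bar>\<integral>x. f x - g x \<partial>N\<bar> \<le> e"
    using fg by (auto intro!: abs_integral_subprob_le M.subprob_space_axioms N.subprob_space_axioms)
  then show ?thesis
    using I by (simp add: Bochner_Integration.integral_diff)
qed

text \<open>Lipschitz regularisation \<open>h x = inf\<^sub>y (f y + L d(x, y))\<close> with \<open>L = 2 B / \<delta>\<close>: points farther
  than \<open>\<delta>\<close> from \<open>x\<close> cannot compete, the others change \<open>f\<close> by at most \<open>e\<close>.\<close>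
lemma integral_diff_le_dBL:
  fixes f :: "'v \<Rightarrow> real"
  assumes [measurable]: "f \<in> borel_measurable borel" and B: "\<And>x. \<bar>f x\<bar> \<le> B" and "0 < e" and d: "0 < d"
    and equi: "\<And>x y. dist x y < d \<Longrightarrow> \<bar>f x - f y\<bar> < e"
  shows "\<bar>(\<integral>x. f x \<partial>M) - (\<integral>x. f x \<partial>N)\<bar> \<le> (1 + B + 2 * B / d) * dBL M N + 2 * e"
proof -
  have B0: "0 \<le> B" using B[of undefined] by linarith
  define L where "L = 2 * B / d"
  have L: "0 \<le> L" using B0 d by (simp add: L_def)
  define h where "h x = (INF y. f y + L * dist x y)" for x
  have lb: "-B \<le> f y + L * dist x y" for x y
    using B[of y] mult_nonneg_nonneg[OF L zero_le_dist[of x y]] by linarith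
  then have bdd: "bdd_below (range (\<lambda>y. f y + L * dist x y))" for x
    by (intro bdd_belowI[of _ "-B"]) auto
  have h_le: "h x \<le> f y + L * dist x y" for x y
    unfolding h_def by (rule cINF_lower[OF bdd]) simp
  have h_upper: "h x \<le> f x" for x using h_le[of x x] by simp
  have h_lower: "f x - e \<le> h x" for x
    unfolding h_def
  proof (rule cINF_greatest)
    fix y
    show "f x - e \<le> f y + L * dist x y"
    proof (cases "dist x y < d")
      case True
      then show ?thesis using equi[OF True] mult_nonneg_nonneg[OF L zero_le_dist[of x y]] by linarith
    next
      case False
      then have "L * d \<le> L * dist x y" using L by (intro mult_left_mono) auto
      moreover have "L * d = 2 * B" using d by (simp add: L_def)
      ultimately show ?thesis using B[of x] B[of y] \<open>0 < e\<close> by linarith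
    qed
  qed simp
  have h_bdd: "\<bar>h x\<bar> \<le> B" for x
  proof -
    have "-B \<le> h x" unfolding h_def by (rule cINF_greatest) (use lb in auto)
    then show ?thesis using h_upper[of x] B[of x] by linarith
  qed
  have h_lip1: "h x - h y \<le> L * dist x y" for x y
  proof -
    have "h x - L * dist x y \<le> h y"
      unfolding h_def[of y]
    proof (rule cINF_greatest)
      fix z
      have "h x \<le> f z + L * dist x z" by (rule h_le)
      also have "\<dots> \<le> f z + L * (dist x y + dist y z)"
        using L by (intro add_left_mono mult_left_mono dist_triangle)
      finally show "h x - L * dist x y \<le> f z + L * dist y z" by (simp add: algebra_simps)
    qed simp
    then show ?thesis by linarith
  qed
  have h_lip: "\<bar>h x - h y\<bar> \<le> L * dist x y" for x y
    using h_lip1[of x y] h_lip1[of y x] by (simp add: dist_commute abs_le_iff)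
  \<comment> \<open>\<open>c\<close> dominates both the sup norm and the Lipschitz constant of
    \<open>h\<close>, so \<open>h / c\<close> is an admissible test function; the summand 1 keeps
    \<open>c\<close> positive when \<open>B = 0\<close>.\<close>
  define c where "c = 1 + B + L"
  have c: "0 < c" "B \<le> c" "L \<le> c" using B0 L by (auto simp: c_def)
  define \<psi> where "\<psi> x = h x / c" for x
  have \<psi>: "\<psi> \<in> bl_ball"
    unfolding bl_ball_def
  proof (intro CollectI conjI allI)
    fix x y
    show "\<bar>\<psi> x\<bar> \<le> 1" using h_bdd[of x] c by (simp add: \<psi>_def)
    have "\<bar>\<psi> x - \<psi> y\<bar> = \<bar>h x - h y\<bar> / c"
      using c by (simp add: \<psi>_def diff_divide_distrib[symmetric])
    also have "\<dots> \<le> (c * dist x y) / c"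
      using h_lip[of x y] mult_right_mono[OF c(3) zero_le_dist[of x y]] c by (intro divide_right_mono) linarith+
    finally show "\<bar>\<psi> x - \<psi> y\<bar> \<le> dist x y" using c by simp
  qed
  have h_eq: "h = (\<lambda>x. c * \<psi> x)" using c by (auto simp: \<psi>_def)
  have [measurable]: "h \<in> borel_measurable borel"
    unfolding h_eq using bl_ball_measurable[OF \<psi>] by measurable
  have "\<bar>(\<integral>x. f x \<partial>M) - (\<integral>x. f x \<partial>N)\<bar> \<le> \<bar>(\<integral>x. h x \<partial>M) - (\<integral>x. h x \<partial>N)\<bar> + 2 * e"
  proof (rule integral_diff_uniform[where B = B and B' = B])
    show "\<bar>f x - h x\<bar> \<le> e" for x using h_upper[of x] h_lower[of x] by linarith
  qed (use B h_bdd in auto)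
  also have "\<bar>(\<integral>x. h x \<partial>M) - (\<integral>x. h x \<partial>N)\<bar> = c * \<bar>(\<integral>x. \<psi> x \<partial>M) - (\<integral>x. \<psi> x \<partial>N)\<bar>"
    unfolding h_eq using c by (simp add: right_diff_distrib[symmetric] abs_mult)
  also have "\<dots> \<le> c * dBL M N"
    using bl_ball_le_dBL[OF \<psi>] c by (intro mult_left_mono) auto
  finally show ?thesis by (simp add: c_def L_def)
qed

end

lemma Min_image_diff_le:
  fixes f g :: "'a \<Rightarrow> real"
  assumes "finite S" "S \<noteq> {}" "\<And>s. s \<in> S \<Longrightarrow> \<bar>f s - g s\<bar> \<le> c"
  shows "\<bar>Min (f ` S) - Min (g ` S)\<bar> \<le> c"
proof -
  have *: "Min (f ` S) - c \<le> Min (g ` S)" if "\<And>s. s \<in> S \<Longrightarrow> \<bar>f s - g s\<bar> \<le> c" for f g :: "'a \<Rightarrow> real"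
  proof -
    have "Min (f ` S) - c \<le> g s" if "s \<in> S" for s
    proof -
      have "Min (f ` S) \<le> f s" using assms(1) that by simp
      then show ?thesis using \<open>\<And>s. s \<in> S \<Longrightarrow> \<bar>f s - g s\<bar> \<le> c\<close>[OF that] by linarith
    qed
    then show ?thesis using assms by (auto simp: Min_ge_iff)
  qed
  from *[of f g] *[of g f] assms(3) show ?thesis
    by (fastforce simp: abs_minus_commute abs_le_iff)
qed

text \<open>The countable family consists of McShane extensions of rational data on finite subsets of a countable
  dense set.\<close>
lemma bl_ball_countable_dense:
  assumes comp: "compact (UNIV :: 'v::metric_space set)"
  obtains D :: "('v::metric_space \<Rightarrow> real) set" where "countable D" "D \<subseteq> bl_ball"
    "\<And>\<psi> e. \<psi> \<in> bl_ball \<Longrightarrow> 0 < e \<Longrightarrow> \<exists>\<phi>\<in>D. \<forall>x. \<bar>\<psi> x - \<phi> x\<bar> \<le> e"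
proof -
  obtain X :: "nat \<Rightarrow> 'v list"
    where X: "\<And>k v. \<exists>j<length (X k). dist (X k ! j) v < 1 / Suc k"
    using compact_finite_nets[OF comp] by blast
  define Y where "Y = (\<Union>k. set (X k)) \<times> (\<rat> :: real set)"
  have "countable Y"
    unfolding Y_def by (intro countable_SIGMA countable_UN countable_rat) (auto intro: countable_finite)
  \<comment> \<open>Truncation to \<open>[-1, 1]\<close> is 1-Lipschitz, so it enforces the sup
    bound without spoiling the Lipschitz bound of a minimum of cones.\<close>
  define m where "m S x = max (-1) (min 1 (Min ((\<lambda>(d, q). q + dist x d) ` S)))" for S and x :: 'v
  define D where "D = m ` {S. finite S \<and> S \<subseteq> Y \<and> S \<noteq> {}}"
  show ?thesis
  proof
    have "countable {S. finite S \<and> S \<subseteq> Y}"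
      by (rule countable_Collect_finite_subset) fact
    then show "countable D"
      unfolding D_def by (intro countable_image) (rule countable_subset[rotated], assumption, auto)
    show "D \<subseteq> bl_ball"
    proof
      fix \<phi> assume "\<phi> \<in> D"
      then obtain S where S: "finite S" "S \<noteq> {}" "\<phi> = m S" by (auto simp: D_def)
      have "\<bar>dist x d - dist y d\<bar> \<le> dist x y" for x y d :: 'v
        using abs_dist_diff_le[of x d y] by (simp add: dist_commute)
      then have "\<bar>Min ((\<lambda>(d, q). q + dist x d) ` S) - Min ((\<lambda>(d, q). q + dist y d) ` S)\<bar> \<le> dist x y" for x y
        using S by (intro Min_image_diff_le) auto
      moreover have "\<bar>max (-1) (min 1 a) - max (-1) (min 1 b)\<bar> \<le> \<bar>a - b\<bar>" for a b :: real
        by linarith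
      ultimately have "\<bar>m S x - m S y\<bar> \<le> dist x y" for x y
        unfolding m_def by (rule order_trans[rotated])
      moreover have "\<bar>m S x\<bar> \<le> 1" for x
        unfolding m_def by linarith
      ultimately show "\<phi> \<in> bl_ball"
        unfolding bl_ball_def S(3) by blast
    qed
    fix \<psi> :: "'v \<Rightarrow> real" and e :: real
    assume \<psi>: "\<psi> \<in> bl_ball" and e: "0 < e"
    have \<psi>1: "\<bar>\<psi> x\<bar> \<le> 1" and \<psi>l: "\<bar>\<psi> x - \<psi> y\<bar> \<le> dist x y" for x y
      using \<psi> by (auto simp: bl_ball_def)
    \<comment> \<open>One third of \<open>e\<close> pays for the rational rounding. The net distance
      enters twice, in the cone \<open>dist x d\<close> and in passing from \<open>\<psi> d\<close>
      to \<open>\<psi> x\<close>.\<close>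
    obtain k where k: "1 / real (Suc k) < e / 3"
      using nat_approx_posE[of "e / 3"] e by auto
    have "\<exists>q\<in>\<rat>. \<bar>q - \<psi> d\<bar> \<le> e / 3" for d
      using Rats_dense_in_real[of "\<psi> d" "\<psi> d + e / 3"] e by (auto intro!: bexI)
    then obtain q where q: "\<And>d. q d \<in> \<rat>" "\<And>d. \<bar>q d - \<psi> d\<bar> \<le> e / 3"
      by metis
    define S where "S = (\<lambda>d. (d, q d)) ` set (X k)"
    have ne: "set (X k) \<noteq> {}" using X[of k undefined] by auto
    have "m S \<in> D"
      unfolding D_def by (rule imageI) (use q(1) ne in \<open>auto simp: S_def Y_def\<close>)
    moreover have "\<bar>\<psi> x - m S x\<bar> \<le> e" for x
    proof -
      have *: "Min ((\<lambda>(d, q). q + dist x d) ` S) = Min ((\<lambda>d. q d + dist x d) ` set (X k))"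
        unfolding S_def by (simp add: image_image)
      have 1: "\<psi> x - e \<le> Min ((\<lambda>d. q d + dist x d) ` set (X k))"
      proof -
        have "\<psi> x - e \<le> q d + dist x d" for d
          using q(2)[of d] \<psi>l[of x d] e by linarith
        then show ?thesis using ne by (simp add: Min_ge_iff)
      qed
      obtain d where d: "d \<in> set (X k)" "dist d x < 1 / Suc k"
        using X[of k x] by (metis nth_mem)
      have "Min ((\<lambda>d. q d + dist x d) ` set (X k)) \<le> q d + dist x d"
        using d by (intro Min_le) auto
      also have "\<dots> \<le> \<psi> x + e"
        using q(2)[of d] \<psi>l[of x d] d(2) k unfolding dist_commute[of d x] by linarith
      finally show ?thesis
        using 1 \<psi>1[of x] e unfolding m_def * by linarith
    qed
    ultimately show "\<exists>\<phi>\<in>D. \<forall>x. \<bar>\<psi> x - \<phi> x\<bar> \<le> e" by blast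
  qed
qed

text \<open>Swapping a test function for one of a countable family at uniform distance
  \<open>e / 2\<close> moves the difference of integrals by at most \<open>e\<close>, since both
  measures have mass at most 1. So the countable supremum equals the full one.\<close>

lemma borel_measurable_dBL:
  fixes \<kappa> :: "'a \<Rightarrow> 'v::metric_space measure"
  assumes comp: "compact (UNIV :: 'v set)"
    and \<kappa>: "\<And>x. x \<in> space M \<Longrightarrow> subprob_space (\<kappa> x)" "\<And>x. x \<in> space M \<Longrightarrow> sets (\<kappa> x) = sets borel"
    and N: "subprob_space N" "sets N = sets borel"
    and meas: "\<And>\<psi>. \<psi> \<in> bl_ball \<Longrightarrow> (\<lambda>x. \<integral>v. \<psi> v \<partial>\<kappa> x) \<in> borel_measurable M"
  shows "(\<lambda>x. dBL (\<kappa> x) N) \<in> borel_measurable M"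
proof -
  obtain D :: "('v \<Rightarrow> real) set" where D: "countable D" "D \<subseteq> bl_ball"
    "\<And>\<psi> e. \<psi> \<in> bl_ball \<Longrightarrow> 0 < e \<Longrightarrow> \<exists>\<phi>\<in>D. \<forall>x. \<bar>\<psi> x - \<phi> x\<bar> \<le> e"
    using bl_ball_countable_dense[OF comp] by blast
  have pair: "subprob_borel_pair (\<kappa> x) N" if "x \<in> space M" for x
    using \<kappa>[OF that] N by (simp add: subprob_borel_pair_def subprob_borel_pair_axioms_def)
  have bdd: "bdd_above ((\<lambda>\<psi>. \<bar>(\<integral>v. \<psi> v \<partial>\<kappa> x) - (\<integral>v. \<psi> v \<partial>N)\<bar>) ` D)" if "x \<in> space M" for x
    by (rule bdd_above_mono[OF subprob_borel_pair.bdd_above_bl_ball[OF pair[OF that]]]) (use D(2) in auto)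
  have eq: "dBL (\<kappa> x) N = (SUP \<psi>\<in>D. \<bar>(\<integral>v. \<psi> v \<partial>\<kappa> x) - (\<integral>v. \<psi> v \<partial>N)\<bar>)" if x: "x \<in> space M" for x
  proof (rule antisym)
    interpret subprob_borel_pair "\<kappa> x" N by (rule pair) fact
    have "D \<noteq> {}" using D(3)[OF bl_ball_zero, of 1] by auto
    then show "(SUP \<psi>\<in>D. \<bar>(\<integral>v. \<psi> v \<partial>\<kappa> x) - (\<integral>v. \<psi> v \<partial>N)\<bar>) \<le> dBL (\<kappa> x) N"
      using D(2) bl_ball_le_dBL by (intro cSUP_least) auto
    show "dBL (\<kappa> x) N \<le> (SUP \<psi>\<in>D. \<bar>(\<integral>v. \<psi> v \<partial>\<kappa> x) - (\<integral>v. \<psi> v \<partial>N)\<bar>)"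
      unfolding dBL_eq_SUP
    proof (rule cSUP_least)
      fix \<psi> :: "'v \<Rightarrow> real" assume \<psi>: "\<psi> \<in> bl_ball"
      show "\<bar>(\<integral>v. \<psi> v \<partial>\<kappa> x) - (\<integral>v. \<psi> v \<partial>N)\<bar> \<le> (SUP \<psi>\<in>D. \<bar>(\<integral>v. \<psi> v \<partial>\<kappa> x) - (\<integral>v. \<psi> v \<partial>N)\<bar>)"
      proof (rule field_le_epsilon)
        fix e :: real assume "0 < e"
        then obtain \<phi> where \<phi>: "\<phi> \<in> D" "\<And>x. \<bar>\<psi> x - \<phi> x\<bar> \<le> e / 2"
          using D(3)[OF \<psi>, of "e / 2"] by auto
        have "\<bar>(\<integral>v. \<psi> v \<partial>\<kappa> x) - (\<integral>v. \<psi> v \<partial>N)\<bar> \<le> \<bar>(\<integral>v. \<phi> v \<partial>\<kappa> x) - (\<integral>v. \<phi> v \<partial>N)\<bar> + 2 * (e / 2)"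
          using \<phi> D(2) \<psi>
          by (intro integral_diff_uniform[where B = 1 and B' = 1] bl_ball_measurable) (auto simp: bl_ball_def)
        also have "\<bar>(\<integral>v. \<phi> v \<partial>\<kappa> x) - (\<integral>v. \<phi> v \<partial>N)\<bar> \<le> (SUP \<psi>\<in>D. \<bar>(\<integral>v. \<psi> v \<partial>\<kappa> x) - (\<integral>v. \<psi> v \<partial>N)\<bar>)"
          by (rule cSUP_upper[OF \<phi>(1) bdd[OF x]])
        finally show "\<bar>(\<integral>v. \<psi> v \<partial>\<kappa> x) - (\<integral>v. \<psi> v \<partial>N)\<bar> \<le> (SUP \<psi>\<in>D. \<bar>(\<integral>v. \<psi> v \<partial>\<kappa> x) - (\<integral>v. \<psi> v \<partial>N)\<bar>) + e"
          by simp
      qed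
    qed (use bl_ball_zero in auto)
  qed
  have "(\<lambda>x. SUP \<psi>\<in>D. \<bar>(\<integral>v. \<psi> v \<partial>\<kappa> x) - (\<integral>v. \<psi> v \<partial>N)\<bar>) \<in> borel_measurable M"
    using D(1,2) bdd meas by (intro borel_measurable_cSUP) auto
  then show ?thesis
    using eq by (subst measurable_cong[where g = "\<lambda>x. SUP \<psi>\<in>D. \<bar>(\<integral>v. \<psi> v \<partial>\<kappa> x) - (\<integral>v. \<psi> v \<partial>N)\<bar>"]) auto
qed

text \<open>For nonnegative integrands the Bochner integral is \<open>enn2real\<close> of the
  nonnegative integral, even where the latter is infinite, so measurability carries over from
  there.\<close>

lemma borel_measurable_integral_kernel:
  fixes f :: "'a \<Rightarrow> 'b \<Rightarrow> real"
  assumes f [measurable]: "(\<lambda>(x, y). f x y) \<in> borel_measurable (M \<Otimes>\<^sub>M N)"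
    and L [measurable]: "L \<in> M \<rightarrow>\<^sub>M subprob_algebra N" and nonneg: "\<And>x y. 0 \<le> f x y"
  shows "(\<lambda>x. \<integral>y. f x y \<partial>L x) \<in> borel_measurable M"
proof -
  have "(\<lambda>x. enn2real (\<integral>\<^sup>+ y. ennreal (f x y) \<partial>L x)) \<in> borel_measurable M"
    by (intro borel_measurable_enn2real nn_integral_measurable_subprob_algebra2[where N = N]) measurable
  moreover have "(\<integral>y. f x y \<partial>L x) = enn2real (\<integral>\<^sup>+ y. ennreal (f x y) \<partial>L x)" if "x \<in> space M" for x
  proof (rule integral_eq_nn_integral)
    have "sets (L x) = sets N" using measurable_space[OF L that] by (simp add: space_subprob_algebra)
    moreover have "f x \<in> borel_measurable N" using measurable_Pair2[OF f that] by simp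
    ultimately show "f x \<in> borel_measurable (L x)" by (simp cong: measurable_cong_sets)
  qed (use nonneg in auto)
  ultimately show ?thesis by (simp cong: measurable_cong)
qed

section \<open>Mixture p-values and the posterior mean\<close>

text \<open>The standing assumptions, with \<open>lam\<close> sigma-finite for the sake of Fubini's
  theorem; the general case is reduced to this one at the end. The configuration of primary
  parameters stays outside, so that all bounds come out uniform in it.\<close>

locale partially_bayes_model =
  fixes K :: "'t \<Rightarrow> 'v::metric_space \<Rightarrow> (real \<times> 'u::topological_space) measure"
    and Q :: "'v \<Rightarrow> 'u \<Rightarrow> real measure"
    and p :: "'u \<Rightarrow> 'v \<Rightarrow> real"
    and lam :: "'u measure"
    and Prior :: "'v measure measure"
    and Gs :: "'v measure"
    and \<theta>0 :: 't
  assumes kernel: "\<And>\<theta>'. K \<theta>' \<in> borel \<rightarrow>\<^sub>M prob_algebra TU_space"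
    and lam_sets [measurable_cong]: "sets lam = sets (borel :: 'u measure)"
    and lam_sigma_finite: "sigma_finite_measure lam"
    and dens_meas: "\<And>\<nu>. (\<lambda>u. p u \<nu>) \<in> borel_measurable lam"
    and dens_nonneg: "\<And>u \<nu>. 0 \<le> p u \<nu>"
    and U_law: "\<And>\<theta>' \<nu>. distr (K \<theta>' \<nu>) (borel :: 'u measure) snd = density lam (\<lambda>u. ennreal (p u \<nu>))"
    and Q_kernel: "\<And>\<nu>. Q \<nu> \<in> lam \<rightarrow>\<^sub>M prob_algebra (borel :: real measure)"
    and disint: "\<And>\<nu>. K \<theta>0 \<nu> = density lam (\<lambda>u. ennreal (p u \<nu>)) \<bind> (\<lambda>u. distr (Q \<nu> u) TU_space (\<lambda>t. (t, u)))"
    and A1: "\<And>\<nu> u. absolutely_continuous lborel (Q \<nu> u)"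
    and A2: "compact (UNIV :: 'v set)"
    and A3: "\<forall>\<epsilon>>0. \<exists>\<delta>>0. \<forall>t u \<nu> \<nu>'. dist \<nu> \<nu>' < \<delta> \<longrightarrow> \<bar>Por Q t u \<nu> - Por Q t u \<nu>'\<bar> < \<epsilon>"
    and A4_tight: "\<forall>\<epsilon>>0. \<exists>C. compact C \<and> C \<in> sets (borel :: 'u measure) \<and>
                     (\<forall>\<nu>. measure (density lam (\<lambda>u. ennreal (p u \<nu>))) (UNIV - C) < \<epsilon>)"
    and A4_fin: "\<And>C. compact C \<Longrightarrow> emeasure lam C < \<infinity>"
    and A4_bdd: "\<And>C. compact C \<Longrightarrow> \<exists>B. \<forall>u\<in>C. \<forall>\<nu>. \<bar>p u \<nu>\<bar> \<le> B"
    and A4_equi: "\<And>C. compact C \<Longrightarrow> \<forall>\<epsilon>>0. \<exists>\<delta>>0. \<forall>u\<in>C. \<forall>\<nu> \<nu>'. dist \<nu> \<nu>' < \<delta> \<longrightarrow> \<bar>p u \<nu> - p u \<nu>'\<bar> < \<epsilon>"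
    and prior: "prob_space Prior" and prior_sets [measurable_cong]: "sets Prior = sets (prob_algebra (borel :: 'v measure))"
    and Gs: "prob_space Gs" and Gs_sets [measurable_cong]: "sets Gs = sets (borel :: 'v measure)"
begin

sublocale lam: sigma_finite_measure lam by (rule lam_sigma_finite)
sublocale Prior: prob_space Prior by (rule prior)
sublocale Gs: prob_space Gs by (rule Gs)

lemma space_lam [simp]: "space lam = UNIV"
  using sets_eq_imp_space_eq[OF lam_sets] by simp

lemma space_Prior: "space Prior = {G. sets G = sets borel \<and> prob_space G}"
  using sets_eq_imp_space_eq[OF prior_sets] by (simp add: space_prob_algebra)

lemma Gs_in_prob_algebra: "Gs \<in> space (prob_algebra borel)"
  using Gs Gs_sets by (simp add: space_prob_algebra)

text \<open>Assumption 4 is applied to the compact set \<open>{u}\<close>; the same device bounds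
  \<open>p u\<close>, and later the likelihood at a fixed sample.\<close>

lemma p_continuous: "continuous_on UNIV (p u)"
  unfolding continuous_on_iff
proof safe
  fix \<nu> and e :: real assume "0 < e"
  then obtain d where "0 < d" "\<And>\<nu>'. dist \<nu> \<nu>' < d \<Longrightarrow> \<bar>p u \<nu> - p u \<nu>'\<bar> < e"
    using A4_equi[of "{u}"] by auto
  then show "\<exists>d>0. \<forall>x'\<in>UNIV. dist x' \<nu> < d \<longrightarrow> dist (p u x') (p u \<nu>) < e"
    by (intro exI[of _ d]) (simp add: dist_real_def dist_commute abs_minus_commute)
qed

lemma p_bounded: obtains B where "\<And>\<nu>. p u \<nu> \<le> B" "0 \<le> B"
proof -
  obtain B where "\<And>\<nu>. \<bar>p u \<nu>\<bar> \<le> B" using A4_bdd[of "{u}"] by auto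
  then show ?thesis using that[of B] by (meson abs_ge_zero abs_le_iff order_trans)
qed

lemma p_measurable [measurable]: "(\<lambda>(u, \<nu>). p u \<nu>) \<in> borel_measurable (borel \<Otimes>\<^sub>M borel)"
  by (rule borel_measurable_Caratheodory[OF A2])
     (use dens_meas p_continuous in \<open>auto simp: measurable_cong_sets[OF lam_sets refl]\<close>)

lemma Q_kernel_borel: "Q \<nu> \<in> borel \<rightarrow>\<^sub>M prob_algebra borel"
  using Q_kernel[of \<nu>] by (simp add: measurable_cong_sets[OF lam_sets refl])

lemma prob_space_Q: "prob_space (Q \<nu> u)" and sets_Q [simp]: "sets (Q \<nu> u) = sets borel"
  using measurable_space[OF Q_kernel_borel, of u \<nu>] by (auto simp: space_prob_algebra)

lemma space_Q [simp]: "space (Q \<nu> u) = UNIV"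
  using sets_eq_imp_space_eq[OF sets_Q] by simp

lemma Por_nonneg [simp]: "0 \<le> Por Q t u \<nu>"
  by (simp add: Por_def)

lemma Por_le_1 [simp]: "Por Q t u \<nu> \<le> 1"
  using prob_space.prob_le_1[OF prob_space_Q] by (simp add: Por_def)

lemma Por_0 [simp]: "Por Q 0 u \<nu> = 1"
  using prob_space.prob_space[OF prob_space_Q[of \<nu> u]] by (simp add: Por_def)

lemma Por_continuous: "continuous_on UNIV (Por Q t u)"
  unfolding continuous_on_iff
proof safe
  fix \<nu> and e :: real assume "0 < e"
  then obtain d where "0 < d" "\<And>\<nu>'. dist \<nu> \<nu>' < d \<Longrightarrow> \<bar>Por Q t u \<nu> - Por Q t u \<nu>'\<bar> < e"
    using A3 by meson
  then show "\<exists>d>0. \<forall>x'\<in>UNIV. dist x' \<nu> < d \<longrightarrow> dist (Por Q t u x') (Por Q t u \<nu>) < e"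
    by (intro exI[of _ d]) (simp add: dist_real_def dist_commute abs_minus_commute)
qed

lemma Por_measurable_v [measurable]: "Por Q t u \<in> borel_measurable borel"
  by (rule borel_measurable_continuous_onI[OF Por_continuous])

text \<open>The tail event moves with \<open>t\<close>, so it is viewed as a section of one
  measurable set in the product with an extra real coordinate; for fixed \<open>\<nu>\<close> the
  kernel \<open>Q \<nu>\<close> measures such sections measurably.\<close>

lemma Por_measurable [measurable]:
  "(\<lambda>(z, \<nu>). Por Q (fst z) (snd z) \<nu>) \<in> borel_measurable ((borel \<Otimes>\<^sub>M borel) \<Otimes>\<^sub>M borel)"
proof (rule borel_measurable_Caratheodory[OF A2])
  fix \<nu>
  have [measurable]: "(\<lambda>z. Q \<nu> (snd z)) \<in> (borel :: real measure) \<Otimes>\<^sub>M borel \<rightarrow>\<^sub>M prob_algebra borel"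
    by (rule measurable_compose[OF measurable_snd Q_kernel_borel])
  have "{z \<in> space (((borel :: real measure) \<Otimes>\<^sub>M (borel :: 'u measure)) \<Otimes>\<^sub>M (borel :: real measure)).
      \<bar>fst (fst z)\<bar> \<le> \<bar>snd z\<bar>} \<in> sets (((borel :: real measure) \<Otimes>\<^sub>M (borel :: 'u measure)) \<Otimes>\<^sub>M (borel :: real measure))"
    by measurable
  also have "{z \<in> space (((borel :: real measure) \<Otimes>\<^sub>M (borel :: 'u measure)) \<Otimes>\<^sub>M (borel :: real measure)).
      \<bar>fst (fst z)\<bar> \<le> \<bar>snd z\<bar>} = Sigma (space ((borel :: real measure) \<Otimes>\<^sub>M (borel :: 'u measure))) (\<lambda>z. {s. \<bar>s\<bar> \<ge> \<bar>fst z\<bar>})"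
    by (auto simp: space_pair_measure)
  finally show "(\<lambda>z. Por Q (fst z) (snd z) \<nu>) \<in> borel_measurable (borel \<Otimes>\<^sub>M borel)"
    unfolding Por_def by (intro measure_measurable_prob_algebra2) auto
qed (rule Por_continuous)

definition wPor :: "'v measure \<Rightarrow> real \<Rightarrow> 'u \<Rightarrow> real" where
  "wPor G t u = (\<integral>\<nu>. Por Q t u \<nu> * p u \<nu> \<partial>G)"

text \<open>The partially Bayes p-value function for a known mixing distribution \<open>G\<close>; it is \<open>0\<close> where the
  marginal density vanishes.\<close>
definition Pmix :: "'v measure \<Rightarrow> real \<Rightarrow> 'u \<Rightarrow> real" where
  "Pmix G t u = wPor G t u / marg_dens p G u"

lemma wPor_nonneg [simp]: "0 \<le> wPor G t u"
  unfolding wPor_def by (intro integral_nonneg_AE) (simp add: dens_nonneg)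

lemma marg_dens_nonneg [simp]: "0 \<le> marg_dens p G u"
  unfolding marg_dens_def by (intro integral_nonneg_AE) (simp add: dens_nonneg)

lemma lik_nonneg [simp]: "0 \<le> lik p G us n"
  unfolding lik_def by (intro prod_nonneg) simp

lemma wPor_measurable [measurable]:
  "(\<lambda>(G, z). wPor G (fst z) (snd z)) \<in> borel_measurable (subprob_algebra borel \<Otimes>\<^sub>M (borel \<Otimes>\<^sub>M borel))"
proof -
  have "(\<lambda>x. \<integral>\<nu>. Por Q (fst (snd x)) (snd (snd x)) \<nu> * p (snd (snd x)) \<nu> \<partial>fst x)
     \<in> borel_measurable (subprob_algebra borel \<Otimes>\<^sub>M (borel \<Otimes>\<^sub>M borel))"
  proof (rule borel_measurable_integral_kernel[where N = borel])
    have [measurable]: "(\<lambda>x. Por Q (fst (snd (fst x))) (snd (snd (fst x))) (snd x))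
       \<in> borel_measurable ((subprob_algebra borel \<Otimes>\<^sub>M (borel \<Otimes>\<^sub>M borel)) \<Otimes>\<^sub>M borel)"
      using measurable_compose[OF _ Por_measurable, of "\<lambda>x. (snd (fst x), snd x)"
          "(subprob_algebra borel \<Otimes>\<^sub>M (borel \<Otimes>\<^sub>M borel)) \<Otimes>\<^sub>M borel"] by simp
    have [measurable]: "(\<lambda>x. p (snd (snd (fst x))) (snd x))
       \<in> borel_measurable ((subprob_algebra borel \<Otimes>\<^sub>M ((borel :: real measure) \<Otimes>\<^sub>M borel)) \<Otimes>\<^sub>M borel)"
      using measurable_compose[OF _ p_measurable, of "\<lambda>x. (snd (snd (fst x)), snd x)"
          "(subprob_algebra borel \<Otimes>\<^sub>M ((borel :: real measure) \<Otimes>\<^sub>M borel)) \<Otimes>\<^sub>M borel"] by simp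
    show "(\<lambda>(x, \<nu>). Por Q (fst (snd x)) (snd (snd x)) \<nu> * p (snd (snd x)) \<nu>)
      \<in> borel_measurable ((subprob_algebra borel \<Otimes>\<^sub>M (borel \<Otimes>\<^sub>M borel)) \<Otimes>\<^sub>M borel)"
      unfolding case_prod_beta by measurable
  qed (auto simp: dens_nonneg)
  then show ?thesis by (simp add: wPor_def case_prod_beta)
qed

lemma marg_dens_measurable [measurable]:
  "(\<lambda>(G, u). marg_dens p G u) \<in> borel_measurable (subprob_algebra borel \<Otimes>\<^sub>M borel)"
proof -
  have "(\<lambda>x. \<integral>\<nu>. p (snd x) \<nu> \<partial>fst x) \<in> borel_measurable (subprob_algebra borel \<Otimes>\<^sub>M borel)"
  proof (rule borel_measurable_integral_kernel[where N = borel])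
    show "(\<lambda>(x, \<nu>). p (snd x) \<nu>) \<in> borel_measurable ((subprob_algebra borel \<Otimes>\<^sub>M borel) \<Otimes>\<^sub>M borel)"
      using measurable_compose[OF _ p_measurable, of "\<lambda>x. (snd (fst x), snd x)"
          "(subprob_algebra borel \<Otimes>\<^sub>M borel) \<Otimes>\<^sub>M borel"] by (simp add: case_prod_beta)
  qed (auto simp: dens_nonneg)
  then show ?thesis by (simp add: marg_dens_def case_prod_beta)
qed

lemma measurable_prob_to_subprob [measurable]: "(\<lambda>G. G) \<in> prob_algebra N \<rightarrow>\<^sub>M subprob_algebra N"
  by (rule measurable_prob_algebraD) (rule measurable_ident_sets[OF refl])

lemma lik_measurable [measurable]:
  assumes "\<And>j. j < n \<Longrightarrow> (\<lambda>x. us x j) \<in> M \<rightarrow>\<^sub>M borel" "\<kappa> \<in> M \<rightarrow>\<^sub>M subprob_algebra borel"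
  shows "(\<lambda>x. lik p (\<kappa> x) (us x) n) \<in> borel_measurable M"
  unfolding lik_def
proof (rule borel_measurable_prod)
  fix j assume "j \<in> {..<n}"
  then show "(\<lambda>x. marg_dens p (\<kappa> x) (us x j)) \<in> borel_measurable M"
    using measurable_compose[OF measurable_Pair[OF assms(2) assms(1)] marg_dens_measurable, of j] by simp
qed

lemma
  assumes "subprob_space G" "sets G = sets borel"
  shows integrable_p: "integrable G (p u)" and integrable_Por_p: "integrable G (\<lambda>\<nu>. Por Q t u \<nu> * p u \<nu>)"
    and wPor_le_marg_dens: "wPor G t u \<le> marg_dens p G u"
proof -
  obtain B where B: "\<And>\<nu>. p u \<nu> \<le> B" "0 \<le> B" by (rule p_bounded[of u]) blast
  note [measurable_cong] = assms(2)
  have le: "Por Q t u \<nu> * p u \<nu> \<le> p u \<nu>" for \<nu>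
    using mult_right_mono[OF Por_le_1 dens_nonneg] by simp
  show 1: "integrable G (p u)"
    using B dens_nonneg by (intro integrable_subprob_bounded[OF assms(1), of _ B]) auto
  show 2: "integrable G (\<lambda>\<nu>. Por Q t u \<nu> * p u \<nu>)"
    using B order_trans[OF le] dens_nonneg by (intro integrable_subprob_bounded[OF assms(1), of _ B]) auto
  show "wPor G t u \<le> marg_dens p G u"
    unfolding wPor_def marg_dens_def by (rule integral_mono[OF 2 1 le])
qed

lemma lik_bounded: "\<exists>B. \<forall>G. subprob_space G \<longrightarrow> sets G = sets borel \<longrightarrow> lik p G us n \<le> B"
proof -
  have "\<exists>B. \<forall>\<nu>. \<bar>p (us j) \<nu>\<bar> \<le> B" for j
    using A4_bdd[of "{us j}"] by simp
  then obtain B where B: "\<And>j \<nu>. \<bar>p (us j) \<nu>\<bar> \<le> B j" by metis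
  have "lik p G us n \<le> (\<Prod>j<n. B j)" if "subprob_space G" "sets G = sets borel" for G
    unfolding lik_def marg_dens_def
  proof (rule prod_mono, safe)
    fix j
    show "0 \<le> (\<integral>\<nu>. p (us j) \<nu> \<partial>G)" using marg_dens_nonneg by (simp add: marg_dens_def)
    note [measurable_cong] = that(2)
    show "(\<integral>\<nu>. p (us j) \<nu> \<partial>G) \<le> B j"
      using abs_integral_subprob_le[OF that(1), of "p (us j)" "B j"] B by simp
  qed
  then show ?thesis by blast
qed

section \<open>Posterior of the mixing distribution and its mean\<close>

abbreviation evidence :: "(nat \<Rightarrow> 'u) \<Rightarrow> nat \<Rightarrow> real" where
  "evidence us n \<equiv> (\<integral>G. lik p G us n \<partial>Prior)"

lemma subprob_Prior:
  assumes "G \<in> space Prior" shows "subprob_space G" "sets G = sets borel" "prob_space G"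
  using assms by (auto simp: space_Prior prob_space_imp_subprob_space)

lemma integrable_lik: "integrable Prior (\<lambda>G. lik p G us n)"
proof -
  obtain B where "\<And>G. subprob_space G \<Longrightarrow> sets G = sets borel \<Longrightarrow> lik p G us n \<le> B"
    using lik_bounded by blast
  then show ?thesis
    by (intro Prior.integrable_const_bound[of _ B] AE_I2) (auto dest: subprob_Prior)
qed

text \<open>The posterior of \<open>G\<close>; the null measure if the evidence vanishes, in agreement with \<^term>\<open>post_mean\<close>.\<close>
definition posterior :: "(nat \<Rightarrow> 'u) \<Rightarrow> nat \<Rightarrow> 'v measure measure" where
  "posterior us n = density Prior (\<lambda>G. ennreal (lik p G us n / evidence us n))"

lemma sets_posterior [simp, measurable_cong]: "sets (posterior us n) = sets (prob_algebra borel)"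
  by (simp add: posterior_def prior_sets)

lemma space_posterior [simp]: "space (posterior us n) = space Prior"
  by (simp add: posterior_def)

lemma subprob_space_posterior: "subprob_space (posterior us n)"
proof (rule subprob_spaceI)
  have "emeasure (posterior us n) (space (posterior us n)) = (\<integral>\<^sup>+G. ennreal (lik p G us n / evidence us n) \<partial>Prior)"
    unfolding posterior_def by (subst emeasure_density) (auto intro!: nn_integral_cong)
  also have "\<dots> = ennreal (evidence us n / evidence us n)"
    by (subst nn_integral_eq_integral) (auto simp: integrable_lik)
  \<comment> \<open>The quotient is 1, or 0 by convention when the evidence vanishes.\<close>
  also have "\<dots> \<le> 1" by (simp add: divide_le_eq_1)
  finally show "emeasure (posterior us n) (space (posterior us n)) \<le> 1" .
  show "space (posterior us n) \<noteq> {}" using Prior.not_empty by simp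
qed

text \<open>A \<open>measure_of\<close> carries its prescribed values only if they are countably
  additive. Recognising them as those of a mixture of \<open>G\<close> over its posterior settles
  this and opens the integration rules for \<open>bind\<close>.\<close>

lemma post_mean_eq: "post_mean Prior p us n = posterior us n \<bind> (\<lambda>G. G)"
proof -
  have meas [measurable]: "(\<lambda>G. G) \<in> posterior us n \<rightarrow>\<^sub>M subprob_algebra borel"
    using measurable_prob_to_subprob by simp
  have "emeasure (posterior us n \<bind> (\<lambda>G. G)) A
      = ennreal ((\<integral>G. measure G A * lik p G us n \<partial>Prior) / evidence us n)" if [measurable]: "A \<in> sets borel" for A
  proof -
    have "emeasure (posterior us n \<bind> (\<lambda>G. G)) A = (\<integral>\<^sup>+G. emeasure G A \<partial>posterior us n)"
      using Prior.not_empty by (subst emeasure_bind[OF _ meas]) auto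
    also have "\<dots> = (\<integral>\<^sup>+G. ennreal (lik p G us n / evidence us n) * emeasure G A \<partial>Prior)"
      unfolding posterior_def by (rule nn_integral_density) measurable
    also have "\<dots> = (\<integral>\<^sup>+G. ennreal (measure G A * lik p G us n / evidence us n) \<partial>Prior)"
    proof (rule nn_integral_cong)
      fix G assume "G \<in> space Prior"
      then interpret G: prob_space G by (rule subprob_Prior)
      show "ennreal (lik p G us n / evidence us n) * emeasure G A = ennreal (measure G A * lik p G us n / evidence us n)"
        by (simp add: G.emeasure_eq_measure ennreal_mult[symmetric] mult.commute)
    qed
    also have "\<dots> = ennreal (\<integral>G. measure G A * lik p G us n / evidence us n \<partial>Prior)"
    proof (rule nn_integral_eq_integral)
      obtain B where "\<And>G. subprob_space G \<Longrightarrow> sets G = sets borel \<Longrightarrow> lik p G us n \<le> B"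
        using lik_bounded by blast
      then have "norm (measure G A * lik p G us n) \<le> B" if "G \<in> space Prior" for G
        using subprob_Prior[OF that] mult_right_mono[OF prob_space.prob_le_1[OF subprob_Prior(3)[OF that], of A] lik_nonneg[of G us n]]
        by (fastforce simp: abs_mult)
      then show "integrable Prior (\<lambda>G. measure G A * lik p G us n / evidence us n)"
        by (intro integrable_divide Prior.integrable_const_bound[of _ B] AE_I2) auto
    qed simp
    finally show ?thesis by simp
  qed
  then have "post_mean Prior p us n
      = measure_of (space (posterior us n \<bind> (\<lambda>G. G))) (sets (posterior us n \<bind> (\<lambda>G. G))) (emeasure (posterior us n \<bind> (\<lambda>G. G)))"
    unfolding post_mean_def using Prior.not_empty
    by (subst sets_bind[OF sets_kernel[OF meas]] space_bind[OF sets_kernel[OF meas]]; simp)+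
       (intro measure_of_eq, auto simp: sets.space_closed sets.sigma_sets_eq[of borel, simplified])
  then show ?thesis by (simp add: measure_of_of_measure)
qed

lemma subprob_space_post_mean: "subprob_space (post_mean Prior p us n)"
  and sets_post_mean [simp, measurable_cong]: "sets (post_mean Prior p us n) = sets borel"
proof -
  have meas: "(\<lambda>G. G) \<in> posterior us n \<rightarrow>\<^sub>M subprob_algebra borel"
    using measurable_prob_to_subprob by simp
  show "subprob_space (post_mean Prior p us n)"
    unfolding post_mean_eq by (rule subprob_space_bind[OF subprob_space_posterior meas])
  show "sets (post_mean Prior p us n) = sets borel"
    unfolding post_mean_eq using Prior.not_empty by (intro sets_bind[OF sets_kernel[OF meas]]) auto
qed

lemma integral_post_mean:
  fixes f :: "'v \<Rightarrow> real"
  assumes [measurable]: "f \<in> borel_measurable borel" and B: "\<And>x. \<bar>f x\<bar> \<le> B"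
  shows "(\<integral>\<nu>. f \<nu> \<partial>post_mean Prior p us n) = (\<integral>G. (\<integral>\<nu>. f \<nu> \<partial>G) * lik p G us n \<partial>Prior) / evidence us n"
proof -
  interpret W: subprob_space "posterior us n" by (rule subprob_space_posterior)
  have meas: "(\<lambda>G. G) \<in> posterior us n \<rightarrow>\<^sub>M subprob_algebra borel"
    using measurable_prob_to_subprob by simp
  have "(\<integral>\<nu>. f \<nu> \<partial>post_mean Prior p us n) = (\<integral>G. (\<integral>\<nu>. f \<nu> \<partial>G) \<partial>posterior us n)"
    unfolding post_mean_eq
    by (rule integral_bind[where B = B and B' = 1 and K = borel])
       (auto simp: B meas W.finite_measure_axioms dest!: subprob_Prior(1) subprob_space.emeasure_space_le_1 intro!: AE_I2)
  also have "\<dots> = (\<integral>G. lik p G us n / evidence us n * (\<integral>\<nu>. f \<nu> \<partial>G) \<partial>Prior)"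
    unfolding posterior_def
    by (subst integral_density) (auto intro!: measurable_compose[OF measurable_prob_to_subprob integral_measurable_subprob_algebra])
  finally show ?thesis by (simp add: mult.commute)
qed

text \<open>Renumbers the units other than \<open>i\<close>, because \<open>post_mean\<close> and
  the risk are both indexed by initial segments.\<close>

definition drop_index :: "nat \<Rightarrow> nat \<Rightarrow> nat" where
  "drop_index i j = (if j < i then j else Suc j)"

lemma inj_drop_index: "inj (drop_index i)"
  by (auto simp: inj_def drop_index_def split: if_splits)

lemma drop_index_image:
  assumes "i \<le> m"
  shows "drop_index i ` {..<m} = {..<Suc m} - {i}"
proof
  show "drop_index i ` {..<m} \<subseteq> {..<Suc m} - {i}"
    by (auto simp: drop_index_def)
  show "{..<Suc m} - {i} \<subseteq> drop_index i ` {..<m}"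
  proof
    fix j assume j: "j \<in> {..<Suc m} - {i}"
    show "j \<in> drop_index i ` {..<m}"
    proof (cases "j < i")
      case True
      then show ?thesis using assms by (intro image_eqI[of _ _ j]) (auto simp: drop_index_def)
    next
      case False
      with j have "i < j" "j < Suc m" by auto
      then show ?thesis by (intro image_eqI[of _ _ "j - 1"]) (auto simp: drop_index_def)
    qed
  qed
qed

text \<open>The full likelihood is \<open>marg_dens\<close> at \<open>us i\<close> times the
  likelihood of the others. Numerator and denominator of Bayes' formula are linear in
  \<open>G\<close>, so averaging them over the posterior given the others means evaluating them at
  its mean, and the common evidence cancels.\<close>

lemma pb_pval_eq_Pmix:
  assumes i: "i < Suc m"
  shows "pb_pval Prior p Q (Suc m) i t us = Pmix (post_mean Prior p (\<lambda>j. us (drop_index i j)) m) t (us i)"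
proof -
  define us' where "us' j = us (drop_index i j)" for j
  have lik': "(\<Prod>j\<in>{..<Suc m} - {i}. marg_dens p G (us j)) = lik p G us' m" for G
    using i by (simp add: drop_index_image[symmetric] lik_def us'_def prod.reindex[OF inj_on_subset[OF inj_drop_index]])
  have lik: "lik p G us (Suc m) = marg_dens p G (us i) * lik p G us' m" for G
    using prod.remove[of "{..<Suc m}" i "\<lambda>j. marg_dens p G (us j)"] i lik'[of G] by (simp add: lik_def[of p G us])
  obtain B where B: "\<And>\<nu>. p (us i) \<nu> \<le> B" "0 \<le> B" by (rule p_bounded[of "us i"]) blast
  have *: "\<bar>p (us i) \<nu>\<bar> \<le> B" "\<bar>Por Q t (us i) \<nu> * p (us i) \<nu>\<bar> \<le> B" for \<nu>
    using B dens_nonneg mult_right_mono[OF Por_le_1 dens_nonneg, of t "us i" \<nu> "us i" \<nu>]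
    by (auto simp: abs_mult intro: order_trans)
  have "wPor (post_mean Prior p us' m) t (us i) = (\<integral>G. wPor G t (us i) * lik p G us' m \<partial>Prior) / evidence us' m"
    unfolding wPor_def by (rule integral_post_mean[OF _ *(2)]) measurable
  moreover have "marg_dens p (post_mean Prior p us' m) (us i) = (\<integral>G. marg_dens p G (us i) * lik p G us' m \<partial>Prior) / evidence us' m"
    unfolding marg_dens_def by (rule integral_post_mean[OF _ *(1)]) measurable
  ultimately have P: "Pmix (post_mean Prior p us' m) t (us i)
      = (if evidence us' m = 0 then 0
         else (\<integral>G. wPor G t (us i) * lik p G us' m \<partial>Prior) / (\<integral>G. marg_dens p G (us i) * lik p G us' m \<partial>Prior))"
    by (simp add: Pmix_def)
  \<comment> \<open>With zero evidence the likelihood of the others is 0 almost everywhere under the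
    prior. Then the numerator of \<open>pb_pval\<close> is 0 as well, and both sides of the claim
    are 0.\<close>
  have "(\<integral>G. wPor G t (us i) * lik p G us' m \<partial>Prior) = 0" if "evidence us' m = 0"
  proof -
    have "AE G in Prior. lik p G us' m = 0"
      using that integral_nonneg_eq_0_iff_AE[OF integrable_lik, of us' m] by simp
    then show ?thesis by (intro integral_eq_zero_AE) auto
  qed
  then show ?thesis
    unfolding us'_def[symmetric] P
    by (simp add: pb_pval_def lik lik' wPor_def)
qed

subsection \<open>Stability in the mixing distribution\<close>

lemma subprob_pair_Gs: "subprob_space H \<Longrightarrow> sets H = sets borel \<Longrightarrow> subprob_borel_pair H Gs"
  by (simp add: subprob_borel_pair_def subprob_borel_pair_axioms_def prob_space_imp_subprob_space Gs Gs_sets)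

text \<open>Assumption 3 is uniform in \<open>t\<close> and \<open>u\<close>, Assumption 4 is
  uniform over \<open>C\<close>, and neither sees \<open>H\<close>. So \<open>c\<close> depends on
  \<open>C\<close> and \<open>e\<close> alone, and random values of \<open>H\<close>,
  \<open>t\<close> and \<open>u\<close> may be inserted later.\<close>

lemma wPor_marg_dens_uniform:
  assumes C: "compact C" and e: "0 < e"
  obtains c where "0 \<le> c"
    "\<And>u t H. u \<in> C \<Longrightarrow> subprob_space H \<Longrightarrow> sets H = sets borel \<Longrightarrow>
      \<bar>wPor H t u - wPor Gs t u\<bar> \<le> c * dBL H Gs + e \<and> \<bar>marg_dens p H u - marg_dens p Gs u\<bar> \<le> c * dBL H Gs + e"
proof -
  obtain B0 where B0: "\<And>u \<nu>. u \<in> C \<Longrightarrow> \<bar>p u \<nu>\<bar> \<le> B0"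
    using A4_bdd[OF C] by blast
  define B where "B = max 1 B0"
  have B: "\<And>u \<nu>. u \<in> C \<Longrightarrow> \<bar>p u \<nu>\<bar> \<le> B" "1 \<le> B"
    using B0 by (simp_all add: B_def le_max_iff_disj)
  \<comment> \<open>The two factors contribute \<open>e / 4\<close> each to the oscillation of
    \<open>Por * p\<close>, and the Lipschitz regularisation doubles the resulting
    \<open>e / 2\<close>. \<open>B\<close> was raised to at least 1 so that
    \<open>e / (4 * B)\<close> is positive.\<close>
  obtain d1 where d1: "d1 > 0" "\<And>u \<nu> \<nu>'. u \<in> C \<Longrightarrow> dist \<nu> \<nu>' < d1 \<Longrightarrow> \<bar>p u \<nu> - p u \<nu>'\<bar> < e / 4"
    using A4_equi[OF C] e by (metis divide_pos_pos zero_less_numeral)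
  obtain d2 where d2: "d2 > 0" "\<And>t u \<nu> \<nu>'. dist \<nu> \<nu>' < d2 \<Longrightarrow> \<bar>Por Q t u \<nu> - Por Q t u \<nu>'\<bar> < e / (4 * B)"
    using A3 e B(2) by (metis divide_pos_pos mult_pos_pos zero_less_numeral zero_less_one order_less_le_trans)
  define d where "d = min d1 d2"
  have d: "0 < d" using d1 d2 by (simp add: d_def)
  show ?thesis
  proof
    show "0 \<le> 1 + B + 2 * B / d" using B d by simp
    fix u t and H :: "'v measure"
    assume u: "u \<in> C" and H: "subprob_space H" "sets H = sets borel"
    interpret subprob_borel_pair H Gs by (rule subprob_pair_Gs[OF H])
    have "\<bar>wPor H t u - wPor Gs t u\<bar> \<le> (1 + B + 2 * B / d) * dBL H Gs + 2 * (e / 2)"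
      unfolding wPor_def
    proof (rule integral_diff_le_dBL)
      fix \<nu> \<nu>'
      have "\<bar>Por Q t u \<nu> * p u \<nu>\<bar> \<le> 1 * B"
        unfolding abs_mult using B u by (intro mult_mono) auto
      then show "\<bar>Por Q t u \<nu> * p u \<nu>\<bar> \<le> B" by simp
      assume dd: "dist \<nu> \<nu>' < d"
      have "Por Q t u \<nu> * p u \<nu> - Por Q t u \<nu>' * p u \<nu>'
          = (Por Q t u \<nu> - Por Q t u \<nu>') * p u \<nu> + Por Q t u \<nu>' * (p u \<nu> - p u \<nu>')"
        by (simp add: algebra_simps)
      then have "\<bar>Por Q t u \<nu> * p u \<nu> - Por Q t u \<nu>' * p u \<nu>'\<bar>
          \<le> \<bar>Por Q t u \<nu> - Por Q t u \<nu>'\<bar> * \<bar>p u \<nu>\<bar> + \<bar>Por Q t u \<nu>'\<bar> * \<bar>p u \<nu> - p u \<nu>'\<bar>"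
        by (metis abs_mult abs_triangle_ineq)
      also have "\<dots> \<le> e / (4 * B) * B + 1 * \<bar>p u \<nu> - p u \<nu>'\<bar>"
        using d2(2)[of \<nu> \<nu>' t u] dd B u e by (intro add_mono mult_mono) (auto simp: d_def)
      also have "\<dots> < e / 4 + e / 4"
        using d1(2)[OF u, of \<nu> \<nu>'] dd B(2) by (simp add: d_def)
      finally show "\<bar>Por Q t u \<nu> * p u \<nu> - Por Q t u \<nu>' * p u \<nu>'\<bar> < e / 2" by simp
    qed (use e d in auto)
    moreover have "\<bar>marg_dens p H u - marg_dens p Gs u\<bar> \<le> (1 + B + 2 * B / d) * dBL H Gs + 2 * (e / 2)"
      unfolding marg_dens_def
    proof (rule integral_diff_le_dBL)
      show "\<bar>p u \<nu> - p u \<nu>'\<bar> < e / 2" if "dist \<nu> \<nu>' < d" for \<nu> \<nu>'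
        using d1(2)[OF u, of \<nu> \<nu>'] that e by (simp add: d_def)
    qed (use e d B u in auto)
    ultimately show "\<bar>wPor H t u - wPor Gs t u\<bar> \<le> (1 + B + 2 * B / d) * dBL H Gs + e \<and>
        \<bar>marg_dens p H u - marg_dens p Gs u\<bar> \<le> (1 + B + 2 * B / d) * dBL H Gs + e"
      by simp
  qed
qed

text \<open>Weighting by the fixed density of \<open>Gs\<close> spares a lower bound on the random
  density of \<open>H\<close>: the quotient \<open>wPor H t u / marg_dens p H u\<close> enters only
  as a number between 0 and 1.\<close>

lemma Pmix_diff_le:
  assumes "subprob_space H" "sets H = sets borel"
  shows "marg_dens p Gs u * \<bar>Pmix H t u - Pmix Gs t u\<bar>
    \<le> \<bar>wPor H t u - wPor Gs t u\<bar> + \<bar>marg_dens p H u - marg_dens p Gs u\<bar>"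
proof (cases "marg_dens p Gs u = 0 \<or> marg_dens p H u = 0")
  case True
  \<comment> \<open>If the density of \<open>H\<close> vanishes, then so do
    \<open>Pmix H t u\<close> and \<open>wPor H t u\<close>; the left-hand side is at most
    \<open>wPor Gs t u\<close>, which is the first difference on the right. If the density of
    \<open>Gs\<close> vanishes, the left-hand side is 0.\<close>
  have "wPor Gs t u \<le> marg_dens p Gs u"
    by (rule wPor_le_marg_dens) (auto simp: prob_space_imp_subprob_space Gs Gs_sets)
  moreover have "wPor H t u \<le> marg_dens p H u" by (rule wPor_le_marg_dens[OF assms])
  ultimately show ?thesis using True wPor_nonneg[of H t u] wPor_nonneg[of Gs t u]
    by (auto simp: Pmix_def abs_mult)
next
  case False
  define N N' m m' where "N = wPor H t u" "N' = wPor Gs t u" "m = marg_dens p H u" "m' = marg_dens p Gs u"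
  note defs = this
  have pos: "0 < m" "0 < m'" using False marg_dens_nonneg unfolding defs by (auto simp: less_le)
  have N: "0 \<le> N" "N \<le> m" using wPor_le_marg_dens[OF assms] by (auto simp: defs)
  have "m' * (N / m - N' / m') = (N - N') + (N / m) * (m' - m)"
    using pos by (simp add: field_simps)
  then have "m' * \<bar>N / m - N' / m'\<bar> = \<bar>(N - N') + (N / m) * (m' - m)\<bar>"
    using pos by (metis abs_mult abs_of_pos)
  also have "\<dots> \<le> \<bar>N - N'\<bar> + \<bar>N / m\<bar> * \<bar>m' - m\<bar>"
    by (metis abs_mult abs_triangle_ineq)
  also have "\<dots> \<le> \<bar>N - N'\<bar> + 1 * \<bar>m' - m\<bar>"
    using N pos by (intro add_left_mono mult_right_mono) auto
  finally show ?thesis by (simp add: Pmix_def defs abs_minus_commute)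
qed

subsection \<open>Uniformity of the oracle p-value\<close>

text \<open>The indicators of the tail sets converge at every \<open>s\<close> except
  \<open>t\<close> and \<open>-t\<close>, and Assumption 1 makes these two points null.\<close>

lemma Por_tendsto:
  assumes "T \<longlonglongrightarrow> t"
  shows "(\<lambda>n. Por Q (T n) u \<nu>) \<longlonglongrightarrow> Por Q t u \<nu>"
proof -
  interpret q: prob_space "Q \<nu> u" by (rule prob_space_Q)
  have "{s::real. \<bar>c\<bar> \<le> \<bar>s\<bar>} \<in> sets borel" for c by measurable
  then have meas: "(\<lambda>s. indicator {s. \<bar>c\<bar> \<le> \<bar>s\<bar>} s :: real) \<in> borel_measurable (Q \<nu> u)" for c
    by (intro borel_measurable_indicator) simp
  have "(\<lambda>n. \<integral>s. indicator {s. \<bar>T n\<bar> \<le> \<bar>s\<bar>} s \<partial>Q \<nu> u) \<longlonglongrightarrow> (\<integral>s. (indicator {s. \<bar>t\<bar> \<le> \<bar>s\<bar>} s :: real) \<partial>Q \<nu> u)"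
  proof (rule integral_dominated_convergence[where w = "\<lambda>_. 1"])
    have "{t, -t} \<in> null_sets (Q \<nu> u)"
      using A1[of \<nu> u] finite_imp_null_set_lborel[of "{t, -t}"] by (auto simp: absolutely_continuous_def)
    then have "AE s in Q \<nu> u. s \<notin> {t, -t}" by (rule AE_not_in)
    then show "AE s in Q \<nu> u. (\<lambda>n. indicator {s. \<bar>T n\<bar> \<le> \<bar>s\<bar>} s :: real) \<longlonglongrightarrow> indicator {s. \<bar>t\<bar> \<le> \<bar>s\<bar>} s"
    proof (rule AE_mp, intro AE_I2 impI)
      fix s assume s: "s \<notin> {t, -t}"
      have lim: "(\<lambda>n. \<bar>T n\<bar>) \<longlonglongrightarrow> \<bar>t\<bar>" using assms by (rule tendsto_rabs)
      from s consider "\<bar>t\<bar> < \<bar>s\<bar>" | "\<bar>s\<bar> < \<bar>t\<bar>" by force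
      then show "(\<lambda>n. indicator {s. \<bar>T n\<bar> \<le> \<bar>s\<bar>} s :: real) \<longlonglongrightarrow> indicator {s. \<bar>t\<bar> \<le> \<bar>s\<bar>} s"
      proof cases
        case 1
        then have "eventually (\<lambda>n. \<bar>T n\<bar> < \<bar>s\<bar>) sequentially" using lim by (simp add: order_tendsto_iff)
        then show ?thesis using 1 by (intro tendsto_eventually) (auto elim!: eventually_mono simp: indicator_def)
      next
        case 2
        then have "eventually (\<lambda>n. \<bar>s\<bar> < \<bar>T n\<bar>) sequentially" using lim by (simp add: order_tendsto_iff)
        then show ?thesis using 2 by (intro tendsto_eventually) (auto elim!: eventually_mono simp: indicator_def)
      qed
    qed
  qed (rule meas, rule meas, auto split: split_indicator)
  then show ?thesis by (simp add: Por_def)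
qed

lemma Por_tendsto_0: "(\<lambda>n. Por Q (real n) u \<nu>) \<longlonglongrightarrow> 0"
proof -
  interpret q: prob_space "Q \<nu> u" by (rule prob_space_Q)
  have "{s::real. \<bar>c\<bar> \<le> \<bar>s\<bar>} \<in> sets borel" for c by measurable
  then have meas: "(\<lambda>s. indicator {s. \<bar>c\<bar> \<le> \<bar>s\<bar>} s :: real) \<in> borel_measurable (Q \<nu> u)" for c
    by (intro borel_measurable_indicator) simp
  have "(\<lambda>n. \<integral>s. indicator {s. \<bar>real n\<bar> \<le> \<bar>s\<bar>} s \<partial>Q \<nu> u) \<longlonglongrightarrow> (\<integral>s. (0 :: real) \<partial>Q \<nu> u)"
  proof (rule integral_dominated_convergence[where w = "\<lambda>_. 1"])
    show "AE s in Q \<nu> u. (\<lambda>n. indicator {s. \<bar>real n\<bar> \<le> \<bar>s\<bar>} s :: real) \<longlonglongrightarrow> 0"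
    proof (rule AE_I2)
      fix s :: real
      have "eventually (\<lambda>n. \<bar>s\<bar> < real n) sequentially"
        using filterlim_real_sequentially by (simp add: filterlim_at_top_dense)
      then show "(\<lambda>n. indicator {s. \<bar>real n\<bar> \<le> \<bar>s\<bar>} s :: real) \<longlonglongrightarrow> 0"
        by (intro tendsto_eventually) (auto elim!: eventually_mono simp: indicator_def)
    qed
  qed (simp, rule meas, auto split: split_indicator)
  then show ?thesis by (simp add: Por_def)
qed

text \<open>The limit \<open>f\<close> is left free to serve twice: \<open>f = Por Q t u\<close>
  gives continuity in \<open>t\<close>, and \<open>f = 0\<close> gives decay at infinity.\<close>

lemma wPor_tendsto:
  assumes "\<And>\<nu>. (\<lambda>n. Por Q (T n) u \<nu>) \<longlonglongrightarrow> f \<nu>"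
  shows "(\<lambda>n. wPor Gs (T n) u) \<longlonglongrightarrow> (\<integral>\<nu>. f \<nu> * p u \<nu> \<partial>Gs)"
  unfolding wPor_def
proof (rule integral_dominated_convergence[where w = "p u"])
  have [measurable]: "f \<in> borel_measurable borel"
    by (rule borel_measurable_LIMSEQ_real[OF assms]) measurable
  show "(\<lambda>\<nu>. f \<nu> * p u \<nu>) \<in> borel_measurable Gs" by measurable
  show "integrable Gs (p u)"
    by (rule integrable_p) (auto simp: prob_space_imp_subprob_space Gs Gs_sets)
  show "AE \<nu> in Gs. (\<lambda>n. Por Q (T n) u \<nu> * p u \<nu>) \<longlonglongrightarrow> f \<nu> * p u \<nu>"
    using assms by (intro AE_I2 tendsto_intros)
  show "AE \<nu> in Gs. norm (Por Q (T n) u \<nu> * p u \<nu>) \<le> p u \<nu>" for n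
    using mult_right_mono[OF Por_le_1 dens_nonneg] dens_nonneg by (intro AE_I2) (simp add: abs_mult)
qed measurable

lemma Por_abs: "Por Q \<bar>t\<bar> u \<nu> = Por Q t u \<nu>"
  by (simp add: Por_def)

lemma Por_antimono: "\<bar>s\<bar> \<le> \<bar>t\<bar> \<Longrightarrow> Por Q t u \<nu> \<le> Por Q s u \<nu>"
proof -
  interpret q: prob_space "Q \<nu> u" by (rule prob_space_Q)
  have "{s::real. \<bar>c\<bar> \<le> \<bar>s\<bar>} \<in> sets borel" for c by measurable
  then show "\<bar>s\<bar> \<le> \<bar>t\<bar> \<Longrightarrow> Por Q t u \<nu> \<le> Por Q s u \<nu>"
    unfolding Por_def by (intro q.finite_measure_mono) auto
qed

lemma wPor_antimono: "\<bar>s\<bar> \<le> \<bar>t\<bar> \<Longrightarrow> wPor Gs t u \<le> wPor Gs s u"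
  unfolding wPor_def
  by (intro integral_mono integrable_Por_p mult_right_mono Por_antimono dens_nonneg)
     (auto simp: prob_space_imp_subprob_space Gs Gs_sets)

lemma wPor_0: "wPor Gs 0 u = marg_dens p Gs u"
  by (simp add: wPor_def marg_dens_def)

lemma wPor_continuous: "continuous_on UNIV (\<lambda>t. wPor Gs t u)"
  unfolding continuous_on_sequentially
proof safe
  fix T :: "nat \<Rightarrow> real" and t assume "T \<longlonglongrightarrow> t"
  from wPor_tendsto[OF Por_tendsto[OF this]]
  show "((\<lambda>t. wPor Gs t u) \<circ> T) \<longlonglongrightarrow> wPor Gs t u" by (simp add: wPor_def comp_def)
qed

text \<open>In \<open>\<bar>t\<bar>\<close>, \<open>wPor Gs t u\<close> decreases continuously from
  \<open>marg_dens p Gs u\<close> to 0 and so attains every intermediate level. For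
  \<open>\<alpha> = 0\<close> this would fail: the value 0 may be approached without being
  attained.\<close>

lemma Pmix_level_set:
  assumes \<alpha>: "0 < \<alpha>" "\<alpha> \<le> 1"
  shows "\<exists>c. {t. Pmix Gs t u \<le> \<alpha>} = {t. \<bar>c\<bar> \<le> \<bar>t\<bar>} \<and> wPor Gs c u = \<alpha> * marg_dens p Gs u"
proof (cases "marg_dens p Gs u = 0")
  case True
  \<comment> \<open>Here \<open>Pmix\<close> is identically 0 and the level set is everything, so
    the threshold 0 fits.\<close>
  then show ?thesis using \<alpha> by (intro exI[of _ 0]) (auto simp: Pmix_def wPor_0)
next
  case False
  define m where "m = marg_dens p Gs u"
  have m: "0 < m" using False marg_dens_nonneg[of Gs u] unfolding m_def by linarith
  have iff: "Pmix Gs t u \<le> \<alpha> \<longleftrightarrow> wPor Gs t u \<le> \<alpha> * m" for t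
    using m by (simp add: Pmix_def m_def[symmetric] field_simps)
  have "(\<lambda>n. wPor Gs (real n) u) \<longlonglongrightarrow> 0"
    using wPor_tendsto[OF Por_tendsto_0] by simp
  then have "eventually (\<lambda>n. wPor Gs (real n) u < \<alpha> * m) sequentially"
    using \<alpha> m by (auto simp: order_tendsto_iff)
  then obtain n where n: "wPor Gs (real n) u < \<alpha> * m"
    using eventually_happens by force
  have "\<exists>x\<ge>0. x \<le> real n \<and> wPor Gs x u = \<alpha> * m"
    using n \<alpha> m by (intro IVT2') (auto simp: wPor_0 m_def[symmetric] intro: continuous_on_subset[OF wPor_continuous])
  then obtain c0 where c0: "0 \<le> c0" "wPor Gs c0 u = \<alpha> * m" by blast
  \<comment> \<open>The function may be flat at this level to the left of \<open>c0\<close>, so the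
    threshold has to be the leftmost point.\<close>
  define S where "S = {t. 0 \<le> t \<and> wPor Gs t u \<le> \<alpha> * m}"
  have "closed S"
    unfolding S_def by (intro closed_Collect_conj closed_Collect_le continuous_intros wPor_continuous)
  moreover have bdd: "bdd_below S" by (auto simp: S_def bdd_below_def)
  moreover have c0S: "c0 \<in> S" using c0 by (simp add: S_def)
  ultimately have c: "Inf S \<in> S" by (intro closed_contains_Inf) auto
  have "Inf S \<le> c0" using c0S bdd by (rule cInf_lower)
  then have "wPor Gs c0 u \<le> wPor Gs (Inf S) u"
    using c by (intro wPor_antimono) (auto simp: S_def)
  then have eq: "wPor Gs (Inf S) u = \<alpha> * m" using c c0 by (simp add: S_def)
  have "wPor Gs t u \<le> \<alpha> * m \<longleftrightarrow> \<bar>Inf S\<bar> \<le> \<bar>t\<bar>" for t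
  proof
    assume "wPor Gs t u \<le> \<alpha> * m"
    then have "\<bar>t\<bar> \<in> S" by (simp add: S_def wPor_def Por_abs)
    then show "\<bar>Inf S\<bar> \<le> \<bar>t\<bar>" using cInf_lower[OF _ bdd] c by (simp add: S_def)
  next
    assume "\<bar>Inf S\<bar> \<le> \<bar>t\<bar>"
    from wPor_antimono[OF this, of u] show "wPor Gs t u \<le> \<alpha> * m" using eq by simp
  qed
  then show ?thesis using eq iff by (intro exI[of _ "Inf S"]) (auto simp: m_def)
qed

section \<open>Law of the data of one unit under the mixing distribution \<open>Gs\<close>\<close>

lemma Gs_kernel_measure:
  assumes "A \<in> sets TU_space"
  shows "emeasure (Gs \<bind> K \<theta>') A = (\<integral>\<^sup>+\<nu>. emeasure (K \<theta>' \<nu>) A \<partial>Gs)"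
  by (rule emeasure_bind_prob_algebra[OF Gs_in_prob_algebra kernel assms])

lemma sets_TU: "sets TU_space = sets (borel \<Otimes>\<^sub>M borel)" and space_TU [simp]: "space TU_space = UNIV"
  by (simp_all add: TU_space_def space_pair_measure)

lemma K_theta0_measure:
  assumes A: "A \<in> sets TU_space"
  shows "emeasure (K \<theta>0 \<nu>) A = (\<integral>\<^sup>+u. ennreal (p u \<nu>) * emeasure (Q \<nu> u) {t. (t, u) \<in> A} \<partial>lam)"
proof -
  have [measurable]: "(\<lambda>u. distr (Q \<nu> u) TU_space (\<lambda>t. (t, u))) \<in> borel \<rightarrow>\<^sub>M prob_algebra TU_space"
    using Q_kernel_borel[of \<nu>]
    by (rule measurable_distr_prob_space2) (simp add: TU_space_def case_prod_beta)
  have [measurable]: "(\<lambda>t. (t, u)) \<in> borel \<rightarrow>\<^sub>M TU_space" for u :: 'u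
    unfolding TU_space_def by measurable
  have meas: "(\<lambda>u. distr (Q \<nu> u) TU_space (\<lambda>t. (t, u))) \<in> density lam (\<lambda>u. ennreal (p u \<nu>)) \<rightarrow>\<^sub>M subprob_algebra TU_space"
    by (rule measurable_prob_algebraD) (simp add: measurable_cong_sets[OF lam_sets refl])
  have e: "emeasure (distr (Q \<nu> u) TU_space (\<lambda>t. (t, u))) A = emeasure (Q \<nu> u) {t. (t, u) \<in> A}" for u
    using A by (subst emeasure_distr) (auto simp: measurable_cong_sets[OF sets_Q refl] vimage_def)
  have [measurable]: "(\<lambda>u. emeasure (Q \<nu> u) {t. (t, u) \<in> A}) \<in> borel_measurable lam"
    unfolding e[symmetric]
    using measurable_compose[OF measurable_prob_algebraD measurable_emeasure_subprob_algebra[OF A],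
        of "\<lambda>u. distr (Q \<nu> u) TU_space (\<lambda>t. (t, u))" borel]
    by (simp add: measurable_cong_sets[OF lam_sets refl])
  have [measurable]: "(\<lambda>u. p u \<nu>) \<in> borel_measurable lam" by (rule dens_meas)
  show ?thesis
    unfolding disint
    by (subst emeasure_bind[OF _ meas A]) (simp_all add: e nn_integral_density)
qed

lemma Fubini_Gs_lam:
  assumes [measurable]: "(\<lambda>(u, \<nu>). f u \<nu>) \<in> borel_measurable (borel \<Otimes>\<^sub>M borel)"
  shows "(\<integral>\<^sup>+\<nu>. \<integral>\<^sup>+u. f u \<nu> \<partial>lam \<partial>Gs) = (\<integral>\<^sup>+u. \<integral>\<^sup>+\<nu>. f u \<nu> \<partial>Gs \<partial>lam)"
proof -
  interpret pair_sigma_finite lam Gs ..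
  show ?thesis
    by (rule Fubini') (simp add: measurable_cong_sets[OF sets_pair_measure_cong[OF lam_sets Gs_sets] refl])
qed

lemma nn_integral_Por_p: "(\<integral>\<^sup>+\<nu>. ennreal (p u \<nu>) * ennreal (Por Q t u \<nu>) \<partial>Gs) = ennreal (wPor Gs t u)"
  unfolding wPor_def
  by (subst nn_integral_eq_integral[OF integrable_Por_p, symmetric])
     (auto intro!: nn_integral_cong simp: ennreal_mult dens_nonneg mult.commute prob_space_imp_subprob_space Gs Gs_sets)

lemma nn_integral_p: "(\<integral>\<^sup>+\<nu>. ennreal (p u \<nu>) \<partial>Gs) = ennreal (marg_dens p Gs u)"
  unfolding marg_dens_def
  by (subst nn_integral_eq_integral[symmetric])
     (auto intro!: integrable_p simp: dens_nonneg prob_space_imp_subprob_space Gs Gs_sets)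

lemma p_measurable_ennreal [measurable]: "(\<lambda>(u, \<nu>). ennreal (p u \<nu>)) \<in> borel_measurable (borel \<Otimes>\<^sub>M borel)"
  using measurable_compose[OF p_measurable measurable_ennreal] by (simp add: case_prod_beta)

lemma K_marginal:
  assumes B: "B \<in> sets borel"
  shows "emeasure (K \<theta>' \<nu>) {z. snd z \<in> B} = emeasure (density lam (\<lambda>u. ennreal (p u \<nu>))) B"
proof -
  have sK: "sets (K \<theta>' \<nu>) = sets (borel \<Otimes>\<^sub>M borel)"
    using measurable_space[OF kernel, of \<nu> \<theta>'] by (simp add: space_prob_algebra sets_TU)
  have "emeasure (distr (K \<theta>' \<nu>) borel snd) B = emeasure (K \<theta>' \<nu>) (snd -` B \<inter> space (K \<theta>' \<nu>))"
    by (rule emeasure_distr) (simp_all add: measurable_cong_sets[OF sK refl] B)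
  moreover have "snd -` B \<inter> space (K \<theta>' \<nu>) = {z. snd z \<in> B}"
    using sets_eq_imp_space_eq[OF sK] by (auto simp: space_pair_measure)
  ultimately show ?thesis by (simp add: U_law)
qed

lemma snd_vimage_TU: "B \<in> sets borel \<Longrightarrow> {z. snd z \<in> B} \<in> sets (TU_space :: (real \<times> 'u) measure)"
  using measurable_sets[of snd "TU_space :: (real \<times> 'u) measure" borel B] by (simp add: TU_space_def vimage_def space_pair_measure)

text \<open>The kernel enters only through its \<open>U\<close>-marginal, so the formula is the same
  for every \<open>\<theta>'\<close>, null or not.\<close>

lemma U_marginal:
  assumes B [measurable]: "B \<in> sets borel"
  shows "emeasure (Gs \<bind> K \<theta>') {z. snd z \<in> B} = (\<integral>\<^sup>+u. ennreal (marg_dens p Gs u) * indicator B u \<partial>lam)"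
proof -
  have [measurable]: "(\<lambda>u. p u \<nu>) \<in> borel_measurable lam" for \<nu> by (rule dens_meas)
  have "emeasure (Gs \<bind> K \<theta>') {z. snd z \<in> B} = (\<integral>\<^sup>+\<nu>. \<integral>\<^sup>+u. ennreal (p u \<nu>) * indicator B u \<partial>lam \<partial>Gs)"
    by (simp add: Gs_kernel_measure snd_vimage_TU K_marginal emeasure_density)
  also have "\<dots> = (\<integral>\<^sup>+u. \<integral>\<^sup>+\<nu>. ennreal (p u \<nu>) * indicator B u \<partial>Gs \<partial>lam)"
  proof (rule Fubini_Gs_lam)
    show "(\<lambda>(u, \<nu>). ennreal (p u \<nu>) * indicator B u) \<in> borel_measurable (borel \<Otimes>\<^sub>M borel)"
      using p_measurable_ennreal unfolding case_prod_beta by measurable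
  qed
  also have "\<dots> = (\<integral>\<^sup>+u. ennreal (marg_dens p Gs u) * indicator B u \<partial>lam)"
    by (subst nn_integral_multc) (simp_all add: nn_integral_p)
  finally show ?thesis .
qed

lemma prob_space_Gs_K: "prob_space (Gs \<bind> K \<theta>')" and sets_Gs_K: "sets (Gs \<bind> K \<theta>') = sets TU_space"
  using prob_space_bind'[OF Gs_in_prob_algebra kernel] sets_bind'[OF Gs_in_prob_algebra kernel] .

lemma Pmix_measurable [measurable]: "(\<lambda>(G, z). Pmix G (fst z) (snd z)) \<in> borel_measurable (subprob_algebra borel \<Otimes>\<^sub>M (borel \<Otimes>\<^sub>M borel))"
proof -
  have [measurable]: "(\<lambda>x. marg_dens p (fst x) (snd (snd x))) \<in> borel_measurable (subprob_algebra borel \<Otimes>\<^sub>M ((borel :: real measure) \<Otimes>\<^sub>M borel))"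
    using measurable_compose[OF _ marg_dens_measurable, of "\<lambda>x. (fst x, snd (snd x))"
          "(subprob_algebra borel \<Otimes>\<^sub>M ((borel :: real measure) \<Otimes>\<^sub>M borel))"] by simp
  show ?thesis
    unfolding Pmix_def using wPor_measurable by (simp add: case_prod_beta)
qed

lemma Pmix_Gs_measurable [measurable]: "(\<lambda>z. Pmix Gs (fst z) (snd z)) \<in> borel_measurable (borel \<Otimes>\<^sub>M borel)"
  using measurable_compose[OF _ Pmix_measurable, of "\<lambda>z. (Gs, z)" "borel \<Otimes>\<^sub>M borel"]
    measurable_space[OF measurable_prob_to_subprob Gs_in_prob_algebra] by simp

lemma marg_dens_Gs_measurable [measurable]: "marg_dens p Gs \<in> borel_measurable borel"
  using measurable_compose[OF _ marg_dens_measurable, of "\<lambda>u. (Gs, u)" borel]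
    measurable_space[OF measurable_prob_to_subprob Gs_in_prob_algebra] by simp

text \<open>Level sets of the oracle are of the form \<open>\<bar>t\<bar> \<ge> c(u)\<close>, so that \<^const>\<open>Por\<close> is the only aspect of
  \<open>Q\<close> that enters; joint measurability in \<open>(u, \<nu>)\<close> then comes from equicontinuity in \<open>\<nu>\<close>.\<close>
lemma oracle_uniform_pos:
  assumes \<alpha>: "0 < \<alpha>" "\<alpha> \<le> 1"
  shows "emeasure (Gs \<bind> K \<theta>0) {z. Pmix Gs (fst z) (snd z) \<le> \<alpha>} = ennreal \<alpha>"
proof -
  define A where "A = {z. Pmix Gs (fst z) (snd z) \<le> \<alpha>}"
  have "{z \<in> space (borel \<Otimes>\<^sub>M borel). Pmix Gs (fst z) (snd z) \<le> \<alpha>} \<in> sets ((borel :: real measure) \<Otimes>\<^sub>M borel)"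
    by measurable
  then have A: "A \<in> sets TU_space" by (simp add: sets_TU A_def space_pair_measure)
  obtain c where c: "\<And>u. {t. Pmix Gs t u \<le> \<alpha>} = {t. \<bar>c u\<bar> \<le> \<bar>t\<bar>}" "\<And>u. wPor Gs (c u) u = \<alpha> * marg_dens p Gs u"
    using Pmix_level_set[OF \<alpha>] by metis
  have Au: "{t. (t, u) \<in> A} = {t. \<bar>c u\<bar> \<le> \<bar>t\<bar>}" for u
    using c(1)[of u] by (simp add: A_def)
  have eQ: "emeasure (Q \<nu> u) {t. (t, u) \<in> A} = ennreal (Por Q (c u) u \<nu>)" for u \<nu>
  proof -
    interpret q: prob_space "Q \<nu> u" by (rule prob_space_Q)
    show ?thesis unfolding Au by (simp add: q.emeasure_eq_measure Por_def)
  qed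
  have h [measurable]: "(\<lambda>(u, \<nu>). Por Q (c u) u \<nu>) \<in> borel_measurable (borel \<Otimes>\<^sub>M borel)"
  proof (rule borel_measurable_Caratheodory[OF A2])
    fix \<nu>
    \<comment> \<open>\<open>c\<close> was chosen pointwise and is not known to be measurable. The
      composite \<open>Por Q (c u) u \<nu>\<close> is measurable in \<open>u\<close> nonetheless,
      being the \<open>Q \<nu> u\<close>-mass of the section at \<open>u\<close> of the measurable
      set \<open>A\<close>.\<close>
    have "(SIGMA u:space (borel :: 'u measure). {t. (t, u) \<in> A}) = {z \<in> space (borel \<Otimes>\<^sub>M borel). Pmix Gs (snd z) (fst z) \<le> \<alpha>}"
      by (auto simp: A_def space_pair_measure)
    also have "\<dots> \<in> sets (borel \<Otimes>\<^sub>M borel)"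
      using measurable_compose[OF _ Pmix_Gs_measurable, of "\<lambda>z. (snd z, fst z)" "borel \<Otimes>\<^sub>M borel"] by simp
    finally have "(\<lambda>u. measure (Q \<nu> u) {t. (t, u) \<in> A}) \<in> borel_measurable borel"
      by (intro measure_measurable_prob_algebra2[OF _ Q_kernel_borel])
    moreover have "measure (Q \<nu> u) {t. (t, u) \<in> A} = Por Q (c u) u \<nu>" for u
      unfolding Au Por_def ..
    ultimately show "(\<lambda>u. Por Q (c u) u \<nu>) \<in> borel_measurable borel" by simp
  qed (rule Por_continuous)
  have "emeasure (Gs \<bind> K \<theta>0) A = (\<integral>\<^sup>+\<nu>. \<integral>\<^sup>+u. ennreal (p u \<nu>) * ennreal (Por Q (c u) u \<nu>) \<partial>lam \<partial>Gs)"
    by (simp add: Gs_kernel_measure[OF A] K_theta0_measure[OF A] eQ)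
  also have "\<dots> = (\<integral>\<^sup>+u. \<integral>\<^sup>+\<nu>. ennreal (p u \<nu>) * ennreal (Por Q (c u) u \<nu>) \<partial>Gs \<partial>lam)"
    by (rule Fubini_Gs_lam) (use p_measurable_ennreal measurable_compose[OF h measurable_ennreal] in \<open>simp add: case_prod_beta\<close>)
  also have "\<dots> = (\<integral>\<^sup>+u. ennreal \<alpha> * ennreal (marg_dens p Gs u) \<partial>lam)"
    using \<alpha> by (simp add: nn_integral_Por_p c(2) ennreal_mult)
  also have "\<dots> = ennreal \<alpha> * (\<integral>\<^sup>+u. ennreal (marg_dens p Gs u) * indicator UNIV u \<partial>lam)"
    by (subst nn_integral_cmult) (auto simp: measurable_cong_sets[OF lam_sets refl])
  also have "(\<integral>\<^sup>+u. ennreal (marg_dens p Gs u) * indicator UNIV u \<partial>lam) = emeasure (Gs \<bind> K \<theta>0) (space (Gs \<bind> K \<theta>0))"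
    using sets_eq_imp_space_eq[OF sets_Gs_K, of \<theta>0] by (subst U_marginal[symmetric, of UNIV \<theta>0]) auto
  also have "\<dots> = 1" by (rule prob_space.emeasure_space_1[OF prob_space_Gs_K])
  finally show ?thesis by (simp add: A_def)
qed

lemma oracle_uniform:
  assumes \<alpha>: "0 \<le> \<alpha>" "\<alpha> \<le> 1"
  shows "measure (Gs \<bind> K \<theta>0) {z. Pmix Gs (fst z) (snd z) \<le> \<alpha>} = \<alpha>"
proof (cases "0 < \<alpha>")
  case True
  then show ?thesis using oracle_uniform_pos[OF True] \<alpha> by (simp add: measure_def)
next
  case False
  interpret prob_space "Gs \<bind> K \<theta>0" by (rule prob_space_Gs_K)
  \<comment> \<open>At level 0 a threshold need not exist, so the level set is squeezed into those
    at small positive levels; \<open>e'\<close> is capped at 1 to stay in their range.\<close>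
  have "measure (Gs \<bind> K \<theta>0) {z. Pmix Gs (fst z) (snd z) \<le> 0} \<le> 0 + e" if "0 < e" for e
  proof -
    define e' where "e' = min e 1"
    have e': "0 < e'" "e' \<le> 1" "e' \<le> e" using that by (auto simp: e'_def)
    have "{z \<in> space (borel \<Otimes>\<^sub>M borel). Pmix Gs (fst z) (snd z) \<le> e'} \<in> sets ((borel :: real measure) \<Otimes>\<^sub>M borel)"
      by measurable
    then have "{z. Pmix Gs (fst z) (snd z) \<le> e'} \<in> events"
      unfolding sets_Gs_K by (simp add: sets_TU space_pair_measure)
    then have "measure (Gs \<bind> K \<theta>0) {z. Pmix Gs (fst z) (snd z) \<le> 0} \<le> measure (Gs \<bind> K \<theta>0) {z. Pmix Gs (fst z) (snd z) \<le> e'}"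
      using e' by (intro finite_measure_mono) auto
    also have "\<dots> = e'" using oracle_uniform_pos[OF e'(1,2)] e' by (simp add: measure_def)
    finally show ?thesis using e' by simp
  qed
  then have "measure (Gs \<bind> K \<theta>0) {z. Pmix Gs (fst z) (snd z) \<le> 0} \<le> 0" by (rule field_le_epsilon)
  then show ?thesis using False \<alpha> by (simp add: antisym measure_le_0_iff)
qed

subsection \<open>From the oracle to the partially Bayes p-value\<close>

lemma integral_post_mean_measurable:
  fixes f :: "'v \<Rightarrow> real"
  assumes us [measurable]: "\<And>j. j < n \<Longrightarrow> (\<lambda>x. us x j) \<in> M \<rightarrow>\<^sub>M borel"
    and f [measurable]: "f \<in> borel_measurable borel" and B: "\<And>x. \<bar>f x\<bar> \<le> B"
  shows "(\<lambda>x. \<integral>\<nu>. f \<nu> \<partial>post_mean Prior p (us x) n) \<in> borel_measurable M"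
proof -
  have snd_meas: "snd \<in> M \<Otimes>\<^sub>M Prior \<rightarrow>\<^sub>M subprob_algebra borel"
    using measurable_compose[OF measurable_snd measurable_prob_to_subprob]
    by (simp add: measurable_cong_sets[OF sets_pair_measure_cong[OF refl prior_sets] refl])
  have [measurable]: "(\<lambda>z. lik p (snd z) (us (fst z)) n) \<in> borel_measurable (M \<Otimes>\<^sub>M Prior)"
    by (rule lik_measurable[OF measurable_compose[OF measurable_fst us] snd_meas])
  have [measurable]: "(\<lambda>z. \<integral>\<nu>. f \<nu> \<partial>snd z) \<in> borel_measurable (M \<Otimes>\<^sub>M Prior)"
    using measurable_compose[OF snd_meas integral_measurable_subprob_algebra[OF f]] .
  show ?thesis
    unfolding integral_post_mean[OF f B] by measurable
qed

lemma post_mean_measurable: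
  assumes us: "\<And>j. j < n \<Longrightarrow> (\<lambda>x. us x j) \<in> M \<rightarrow>\<^sub>M borel"
  shows "(\<lambda>x. post_mean Prior p (us x) n) \<in> M \<rightarrow>\<^sub>M subprob_algebra borel"
proof (rule measurable_subprob_algebra)
  fix A :: "'v set" assume A [measurable]: "A \<in> sets borel"
  have "(\<lambda>x. ennreal (\<integral>\<nu>. indicator A \<nu> \<partial>post_mean Prior p (us x) n)) \<in> borel_measurable M"
    by (intro measurable_compose[OF _ measurable_ennreal] integral_post_mean_measurable[OF us, where B = 1])
       (auto split: split_indicator)
  moreover have "emeasure (post_mean Prior p vs n) A = ennreal (\<integral>\<nu>. indicator A \<nu> \<partial>post_mean Prior p vs n)" for vs
  proof -
    interpret subprob_space "post_mean Prior p vs n" by (rule subprob_space_post_mean)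
    show ?thesis by (simp add: emeasure_eq_measure)
  qed
  ultimately show "(\<lambda>x. emeasure (post_mean Prior p (us x) n) A) \<in> borel_measurable M" by simp
qed (auto simp: subprob_space_post_mean)

lemma dBL_post_mean_measurable:
  assumes us: "\<And>j. j < n \<Longrightarrow> (\<lambda>x. us x j) \<in> M \<rightarrow>\<^sub>M borel"
  shows "(\<lambda>x. dBL (post_mean Prior p (us x) n) Gs) \<in> borel_measurable M"
proof (rule borel_measurable_dBL[OF A2])
  show "(\<lambda>x. \<integral>\<nu>. \<psi> \<nu> \<partial>post_mean Prior p (us x) n) \<in> borel_measurable M" if "\<psi> \<in> bl_ball" for \<psi>
    using that by (intro integral_post_mean_measurable[OF us bl_ball_measurable, where B = 1]) (auto simp: bl_ball_def)
qed (auto simp: subprob_space_post_mean prob_space_imp_subprob_space Gs Gs_sets)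

lemma post_mean_cong:
  assumes "\<And>j. j < n \<Longrightarrow> us j = vs j"
  shows "post_mean Prior p us n = post_mean Prior p vs n"
proof -
  have "lik p G us n = lik p G vs n" for G
    unfolding lik_def using assms by (intro prod.cong) auto
  then show ?thesis by (simp add: post_mean_def)
qed

text \<open>Written exactly as the factor of the product measure in the consistency hypothesis, with
  no mention of \<open>K\<close> or of any primary parameter.\<close>

definition U_mix :: "'u measure" where
  "U_mix = Gs \<bind> (\<lambda>\<nu>. density lam (\<lambda>u. ennreal (p u \<nu>)))"

lemma density_kernel: "(\<lambda>\<nu>. density lam (\<lambda>u. ennreal (p u \<nu>))) \<in> borel \<rightarrow>\<^sub>M prob_algebra borel"
proof -
  have "snd \<in> (TU_space :: (real \<times> 'u) measure) \<rightarrow>\<^sub>M borel" by (simp add: TU_space_def)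
  from measurable_compose[OF kernel measurable_distr_prob_space[OF this]]
  show ?thesis by (simp add: U_law)
qed

lemma sets_U_mix [simp, measurable_cong]: "sets U_mix = sets borel" and prob_space_U_mix: "prob_space U_mix"
  unfolding U_mix_def
  using sets_bind'[OF Gs_in_prob_algebra density_kernel] prob_space_bind'[OF Gs_in_prob_algebra density_kernel] .

lemma space_Gs_K [simp]: "space (Gs \<bind> K \<theta>') = UNIV"
  using sets_eq_imp_space_eq[OF sets_Gs_K] by simp

lemma snd_measurable_Gs_K: "snd \<in> (Gs \<bind> K \<theta>') \<rightarrow>\<^sub>M U_mix"
  by (simp add: measurable_cong_sets[OF sets_Gs_K sets_U_mix] TU_space_def)

lemma fst_measurable_Gs_K: "fst \<in> (Gs \<bind> K \<theta>') \<rightarrow>\<^sub>M borel"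
  by (simp add: measurable_cong_sets[OF sets_Gs_K refl] TU_space_def)

text \<open>The point where \<open>\<theta>'\<close> disappears: the \<open>U\<close>-statistics of
  nulls and alternatives have one common law.\<close>

lemma distr_snd_Gs_K: "distr (Gs \<bind> K \<theta>') U_mix snd = U_mix"
proof (rule measure_eqI)
  fix B assume "B \<in> sets (distr (Gs \<bind> K \<theta>') U_mix snd)"
  then have B: "B \<in> sets borel" by simp
  have "emeasure (distr (Gs \<bind> K \<theta>') U_mix snd) B = emeasure (Gs \<bind> K \<theta>') {z. snd z \<in> B}"
    using B by (subst emeasure_distr[OF snd_measurable_Gs_K]) (auto simp: vimage_def)
  also have "\<dots> = (\<integral>\<^sup>+\<nu>. emeasure (density lam (\<lambda>u. ennreal (p u \<nu>))) B \<partial>Gs)"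
    by (simp add: Gs_kernel_measure snd_vimage_TU K_marginal B)
  also have "\<dots> = emeasure U_mix B"
    unfolding U_mix_def by (rule emeasure_bind_prob_algebra[OF Gs_in_prob_algebra density_kernel B, symmetric])
  finally show "emeasure (distr (Gs \<bind> K \<theta>') U_mix snd) B = emeasure U_mix B" .
qed simp

section \<open>Joint law of the sample and of the other units\<close>

definition data_law :: "(nat \<Rightarrow> 't) \<Rightarrow> nat \<Rightarrow> (nat \<Rightarrow> real \<times> 'u) measure" where
  "data_law \<tau> n = PiM {..<n} (\<lambda>j. Gs \<bind> K (\<tau> j))"

lemma prob_space_data_law: "prob_space (data_law \<tau> n)"
  unfolding data_law_def by (intro prob_space_PiM prob_space_Gs_K)

lemma component_measurable: "i < n \<Longrightarrow> (\<lambda>\<omega>. \<omega> i) \<in> data_law \<tau> n \<rightarrow>\<^sub>M (Gs \<bind> K (\<tau> i))"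
  unfolding data_law_def by (rule measurable_component_singleton) simp

lemma data_measurable:
  assumes "i < n"
  shows "(\<lambda>\<omega>. snd (\<omega> i)) \<in> data_law \<tau> n \<rightarrow>\<^sub>M borel" "(\<lambda>\<omega>. fst (\<omega> i)) \<in> data_law \<tau> n \<rightarrow>\<^sub>M borel"
  using measurable_compose[OF component_measurable[OF assms] snd_measurable_Gs_K]
    measurable_compose[OF component_measurable[OF assms] fst_measurable_Gs_K]
  by (simp_all add: measurable_cong_sets[OF refl sets_U_mix])

lemma component_law:
  assumes "i < n" "A \<in> sets TU_space"
  shows "measure (data_law \<tau> n) {\<omega> \<in> space (data_law \<tau> n). \<omega> i \<in> A} = measure (Gs \<bind> K (\<tau> i)) A"
proof -
  have "distr (data_law \<tau> n) (Gs \<bind> K (\<tau> i)) (\<lambda>\<omega>. \<omega> i) = Gs \<bind> K (\<tau> i)"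
    unfolding data_law_def using assms(1) by (intro distr_PiM_component prob_space_Gs_K) auto
  then have "measure (Gs \<bind> K (\<tau> i)) A = measure (distr (data_law \<tau> n) (Gs \<bind> K (\<tau> i)) (\<lambda>\<omega>. \<omega> i)) A" by simp
  also have "\<dots> = measure (data_law \<tau> n) ((\<lambda>\<omega>. \<omega> i) -` A \<inter> space (data_law \<tau> n))"
    by (rule measure_distr[OF component_measurable[OF assms(1)]]) (simp add: sets_Gs_K assms)
  also have "(\<lambda>\<omega>. \<omega> i) -` A \<inter> space (data_law \<tau> n) = {\<omega> \<in> space (data_law \<tau> n). \<omega> i \<in> A}" by auto
  finally show ?thesis by simp
qed

abbreviation others :: "nat \<Rightarrow> (nat \<Rightarrow> real \<times> 'u) \<Rightarrow> nat \<Rightarrow> 'u" where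
  "others i \<omega> \<equiv> \<lambda>j. snd (\<omega> (drop_index i j))"

lemma drop_index_less: "i < Suc m \<Longrightarrow> j < m \<Longrightarrow> drop_index i j < Suc m"
  by (simp add: drop_index_def)

text \<open>Two pushforwards: selecting the coordinates other than \<open>i\<close> gives the
  product of their laws, and projecting each to \<open>U\<close> erases its parameter. The result
  depends on neither \<open>i\<close> nor \<open>\<tau>\<close>.\<close>

lemma others_law:
  assumes i: "i < Suc m"
  shows "distr (data_law \<tau> (Suc m)) (PiM {..<m} (\<lambda>_. U_mix)) (\<lambda>\<omega>. \<lambda>j\<in>{..<m}. others i \<omega> j) = PiM {..<m} (\<lambda>_. U_mix)"
proof -
  define M where "M j = Gs \<bind> K (\<tau> j)" for j
  have pM: "prob_space (M j)" for j unfolding M_def by (rule prob_space_Gs_K)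
  let ?D = "PiM {..<m} (\<lambda>j. M (drop_index i j))"
  let ?r = "\<lambda>\<omega>. \<lambda>j\<in>{..<m}. \<omega> (drop_index i j)"
  have 1: "distr (PiM {..<Suc m} M) ?D ?r = ?D"
    using i by (intro distr_PiM_reindex pM inj_on_subset[OF inj_drop_index]) (auto intro: drop_index_less)
  have "distr ?D (PiM {..<m} (\<lambda>_. U_mix)) (compose {..<m} snd) = PiM {..<m} (\<lambda>j. distr (M (drop_index i j)) U_mix snd)"
    by (rule distr_PiM_finite_prob_space') (auto simp: pM[unfolded M_def] prob_space_U_mix M_def snd_measurable_Gs_K)
  then have 2: "distr ?D (PiM {..<m} (\<lambda>_. U_mix)) (compose {..<m} snd) = PiM {..<m} (\<lambda>_. U_mix)"
    by (simp add: M_def distr_snd_Gs_K)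
  have r: "?r \<in> PiM {..<Suc m} M \<rightarrow>\<^sub>M ?D"
    using i by (intro measurable_restrict measurable_component_singleton) (auto intro: drop_index_less)
  have s: "compose {..<m} snd \<in> ?D \<rightarrow>\<^sub>M PiM {..<m} (\<lambda>_. U_mix)"
    unfolding compose_def
    by (intro measurable_restrict measurable_compose[OF measurable_component_singleton])
       (auto simp: M_def snd_measurable_Gs_K)
  have "PiM {..<m} (\<lambda>_. U_mix) = distr (distr (PiM {..<Suc m} M) ?D ?r) (PiM {..<m} (\<lambda>_. U_mix)) (compose {..<m} snd)"
    by (simp only: 1 2)
  also have "\<dots> = distr (PiM {..<Suc m} M) (PiM {..<m} (\<lambda>_. U_mix)) (compose {..<m} snd \<circ> ?r)"
    by (rule distr_distr[OF s r])
  also have "compose {..<m} snd \<circ> ?r = (\<lambda>\<omega>. \<lambda>j\<in>{..<m}. others i \<omega> j)"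
    by (auto simp: compose_def fun_eq_iff)
  finally show ?thesis unfolding data_law_def M_def by (rule sym)
qed

text \<open>The sequence that the consistency hypothesis sends to 0.\<close>

definition risk :: "nat \<Rightarrow> real" where
  "risk n = (\<integral>us. dBL (post_mean Prior p us n) Gs \<partial>(PiM {..<n} (\<lambda>_. U_mix)))"

lemma others_measurable:
  assumes "i < Suc m" "j < m" shows "(\<lambda>\<omega>. others i \<omega> j) \<in> data_law \<tau> (Suc m) \<rightarrow>\<^sub>M borel"
  by (rule data_measurable(1)) (rule drop_index_less[OF assms])

text \<open>In a sample of size \<open>Suc m\<close> the others number \<open>m\<close>, hence the
  shift by one in the risk.\<close>

lemma expected_dBL_others:
  assumes i: "i < Suc m"
  shows "(\<integral>\<omega>. dBL (post_mean Prior p (others i \<omega>) m) Gs \<partial>data_law \<tau> (Suc m)) = risk m"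
proof -
  have "risk m = (\<integral>us. dBL (post_mean Prior p us m) Gs
      \<partial>distr (data_law \<tau> (Suc m)) (PiM {..<m} (\<lambda>_. U_mix)) (\<lambda>\<omega>. \<lambda>j\<in>{..<m}. others i \<omega> j))"
    by (simp add: risk_def others_law[OF i])
  also have "\<dots> = (\<integral>\<omega>. dBL (post_mean Prior p (\<lambda>j\<in>{..<m}. others i \<omega> j) m) Gs \<partial>data_law \<tau> (Suc m))"
  proof (rule integral_distr)
    show "(\<lambda>\<omega>. \<lambda>j\<in>{..<m}. others i \<omega> j) \<in> data_law \<tau> (Suc m) \<rightarrow>\<^sub>M PiM {..<m} (\<lambda>_. U_mix)"
      using others_measurable[OF i]
      by (intro measurable_restrict) (simp add: measurable_cong_sets[OF refl sets_U_mix])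
    show "(\<lambda>us. dBL (post_mean Prior p us m) Gs) \<in> borel_measurable (PiM {..<m} (\<lambda>_. U_mix))"
      using measurable_component_singleton[of _ "{..<m}" "\<lambda>_. U_mix"]
      by (intro dBL_post_mean_measurable) (simp add: measurable_cong_sets[OF refl sets_U_mix])
  qed
  also have "\<dots> = (\<integral>\<omega>. dBL (post_mean Prior p (others i \<omega>) m) Gs \<partial>data_law \<tau> (Suc m))"
    by (intro Bochner_Integration.integral_cong refl arg_cong2[where f = dBL] post_mean_cong) simp
  finally show ?thesis ..
qed

lemma pval_measurable:
  assumes i: "i < Suc m"
  shows "(\<lambda>\<omega>. pb_pval Prior p Q (Suc m) i (fst (\<omega> i)) (\<lambda>j. snd (\<omega> j))) \<in> borel_measurable (data_law \<tau> (Suc m))"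
  unfolding pb_pval_eq_Pmix[OF i]
  using measurable_compose[OF measurable_Pair[OF post_mean_measurable[OF others_measurable[OF i]]
      measurable_Pair[OF data_measurable(2)[OF i] data_measurable(1)[OF i]]] Pmix_measurable]
  by simp

lemma subprob_pair_post_mean: "subprob_borel_pair (post_mean Prior p us n) Gs"
  by (rule subprob_pair_Gs[OF subprob_space_post_mean sets_post_mean])

section \<open>Comparison with the oracle in probability\<close>

lemma sets_TU_Collect:
  assumes "Measurable.pred (borel \<Otimes>\<^sub>M borel) P" shows "{z. P z} \<in> sets TU_space"
  using predE[OF assms] by (simp add: sets_TU space_pair_measure)

text \<open>The function integrated over this event to give its probability is the very density that
  is below \<open>\<kappa>\<close> there. Points where the quotient \<open>Pmix\<close> is unstable
  are therefore rare.\<close>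

lemma small_marg_dens_prob:
  assumes C: "C \<in> sets borel" "emeasure lam C < \<infinity>" and \<kappa>: "0 < \<kappa>"
  shows "measure (Gs \<bind> K \<theta>') {z. snd z \<in> C \<and> marg_dens p Gs (snd z) < \<kappa>} \<le> \<kappa> * measure lam C"
proof -
  define B where "B = {u \<in> C. marg_dens p Gs u < \<kappa>}"
  have "{u \<in> space borel. marg_dens p Gs u < \<kappa>} \<in> sets borel" by measurable
  then have B: "B \<in> sets borel" using C(1) sets.Int[of C borel "{u. marg_dens p Gs u < \<kappa>}"]
    by (simp add: B_def Collect_conj_eq)
  have "emeasure (Gs \<bind> K \<theta>') {z. snd z \<in> B} = (\<integral>\<^sup>+u. ennreal (marg_dens p Gs u) * indicator B u \<partial>lam)"
    by (rule U_marginal[OF B])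
  also have "\<dots> \<le> (\<integral>\<^sup>+u. ennreal \<kappa> * indicator C u \<partial>lam)"
    by (rule nn_integral_mono) (auto simp: B_def split: split_indicator intro: ennreal_leI)
  also have "\<dots> = ennreal \<kappa> * emeasure lam C"
    using C(1) by (subst nn_integral_cmult_indicator) (simp_all add: lam_sets)
  also have "\<dots> = ennreal (\<kappa> * measure lam C)"
    using C(2) \<kappa> by (simp add: emeasure_eq_ennreal_measure ennreal_mult top.not_eq_extremum)
  finally have "measure (Gs \<bind> K \<theta>') {z. snd z \<in> B} \<le> \<kappa> * measure lam C"
    unfolding measure_def using \<kappa> by (intro enn2real_leI) (auto simp: measure_def[symmetric])
  then show ?thesis by (simp add: B_def)
qed

text \<open>Tightness is uniform in \<open>\<nu>\<close>, hence survives mixing over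
  \<open>Gs\<close>.\<close>

lemma tail_prob:
  assumes C: "C \<in> sets borel" and tight: "\<And>\<nu>. measure (density lam (\<lambda>u. ennreal (p u \<nu>))) (UNIV - C) < e" and e: "0 < e"
  shows "measure (Gs \<bind> K \<theta>') {z. snd z \<notin> C} \<le> e"
proof -
  have B: "UNIV - C \<in> sets borel" using C by auto
  have "emeasure (Gs \<bind> K \<theta>') {z. snd z \<in> UNIV - C} = (\<integral>\<^sup>+\<nu>. emeasure (density lam (\<lambda>u. ennreal (p u \<nu>))) (UNIV - C) \<partial>Gs)"
    by (simp only: Gs_kernel_measure[OF snd_vimage_TU[OF B]] K_marginal[OF B])
  also have "\<dots> \<le> (\<integral>\<^sup>+\<nu>. ennreal e \<partial>Gs)"
  proof (rule nn_integral_mono)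
    fix \<nu>
    interpret d: prob_space "density lam (\<lambda>u. ennreal (p u \<nu>))"
      using measurable_space[OF density_kernel, of \<nu>] by (simp add: space_prob_algebra)
    show "emeasure (density lam (\<lambda>u. ennreal (p u \<nu>))) (UNIV - C) \<le> ennreal e"
      unfolding d.emeasure_eq_measure using tight[of \<nu>] by (intro ennreal_leI) simp
  qed
  also have "\<dots> = ennreal e" using Gs.emeasure_space_1 by simp
  finally show ?thesis
    unfolding measure_def using e by (intro enn2real_leI) auto
qed

text \<open>Where the \<open>U\<close>-marginal density is at least \<open>\<kappa>\<close> and \<open>dBL\<close> is small, \<open>Pmix_diff_le\<close> bounds the error;
  the exceptional events are controlled one at a time, so independence of unit \<open>i\<close> from the rest is never used.\<close>
lemma pval_close_to_oracle:
  assumes e: "0 < e" and \<delta>: "0 < \<delta>"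
  obtains s where "0 < s"
    "\<And>m \<tau> i. i < Suc m \<Longrightarrow> risk m < s \<Longrightarrow>
      measure (data_law \<tau> (Suc m)) {\<omega> \<in> space (data_law \<tau> (Suc m)).
        \<delta> < \<bar>pb_pval Prior p Q (Suc m) i (fst (\<omega> i)) (\<lambda>j. snd (\<omega> j)) - Pmix Gs (fst (\<omega> i)) (snd (\<omega> i))\<bar>} \<le> e"
proof -
  obtain C where C: "compact C" "C \<in> sets borel"
    and tight: "\<And>\<nu>. measure (density lam (\<lambda>u. ennreal (p u \<nu>))) (UNIV - C) < e / 3"
    using A4_tight e by (metis divide_pos_pos zero_less_numeral)
  \<comment> \<open>Makes a small marginal density inside \<open>C\<close> an event of probability
    at most \<open>e / 3\<close>; the summand 1 covers \<open>measure lam C = 0\<close>.\<close>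
  define \<kappa> where "\<kappa> = e / (3 * (measure lam C + 1))"
  have lamC: "0 < measure lam C + 1" using measure_nonneg[of lam C] by linarith
  have \<kappa>: "0 < \<kappa>" using e lamC by (simp add: \<kappa>_def)
  have "\<kappa> * measure lam C \<le> \<kappa> * (measure lam C + 1)" using \<kappa> by (intro mult_left_mono) auto
  also have "\<dots> = e / 3" using lamC by (simp add: \<kappa>_def field_simps)
  finally have \<kappa>C: "\<kappa> * measure lam C \<le> e / 3" .
  obtain c where c: "0 \<le> c"
    "\<And>u t H. u \<in> C \<Longrightarrow> subprob_space H \<Longrightarrow> sets H = sets borel \<Longrightarrow>
      \<bar>wPor H t u - wPor Gs t u\<bar> \<le> c * dBL H Gs + \<kappa> * \<delta> / 4 \<and>
      \<bar>marg_dens p H u - marg_dens p Gs u\<bar> \<le> c * dBL H Gs + \<kappa> * \<delta> / 4"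
    using wPor_marg_dens_uniform[OF C(1), of "\<kappa> * \<delta> / 4"] \<kappa> \<delta> by (metis divide_pos_pos mult_pos_pos zero_less_numeral)
  \<comment> \<open>Where \<open>dBL\<close> is below \<open>s0\<close>, each of the two differences
    is at most twice \<open>\<kappa> * \<delta> / 4\<close>, so their sum is at most
    \<open>\<kappa> * \<delta>\<close>, which a deviation above \<open>\<delta>\<close>
    contradicts.\<close>
  define s0 where "s0 = \<kappa> * \<delta> / (4 * (c + 1))"
  have s0: "0 < s0" using \<kappa> \<delta> c by (simp add: s0_def)
  have "c * s0 \<le> (c + 1) * s0" using s0 by (intro mult_right_mono) auto
  also have "\<dots> = \<kappa> * \<delta> / 4" using c by (simp add: s0_def field_simps)
  finally have cs0: "c * s0 \<le> \<kappa> * \<delta> / 4" .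
  show ?thesis
  proof
    \<comment> \<open>Markov's inequality at threshold \<open>s0\<close> turns this bound on the
      risk into a probability of at most \<open>e / 3\<close>.\<close>
    show "0 < s0 * e / 3" using s0 e by simp
    fix m \<tau> i assume i: "i < Suc m" and risk: "risk m < s0 * e / 3"
    let ?M = "data_law \<tau> (Suc m)"
    interpret M: prob_space ?M by (rule prob_space_data_law)
    define P where "P \<omega> = pb_pval Prior p Q (Suc m) i (fst (\<omega> i)) (\<lambda>j. snd (\<omega> j))" for \<omega> :: "nat \<Rightarrow> real \<times> 'u"
    define R where "R \<omega> = Pmix Gs (fst (\<omega> i)) (snd (\<omega> i))" for \<omega> :: "nat \<Rightarrow> real \<times> 'u"
    define d where "d \<omega> = dBL (post_mean Prior p (others i \<omega>) m) Gs" for \<omega> :: "nat \<Rightarrow> real \<times> 'u"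
    have [measurable]: "d \<in> borel_measurable ?M"
      unfolding d_def by (rule dBL_post_mean_measurable[OF others_measurable[OF i]])
    have d0: "0 \<le> d \<omega>" and d2: "d \<omega> \<le> 2" for \<omega>
      using subprob_borel_pair.dBL_nonneg[OF subprob_pair_post_mean] subprob_borel_pair.dBL_le_2[OF subprob_pair_post_mean]
      by (auto simp: d_def)
    define tail where "tail = {z :: real \<times> 'u. snd z \<notin> C}"
    define low where "low = {z :: real \<times> 'u. snd z \<in> C \<and> marg_dens p Gs (snd z) < \<kappa>}"
    note [measurable] = C(2)
    have A: "tail \<in> sets TU_space" "low \<in> sets TU_space"
      unfolding tail_def low_def by (rule sets_TU_Collect; measurable)+
    have ev [measurable]: "{\<omega> \<in> space ?M. \<omega> i \<in> tail} \<in> sets ?M" "{\<omega> \<in> space ?M. \<omega> i \<in> low} \<in> sets ?M"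
      using measurable_sets[OF component_measurable[OF i, of \<tau>], of tail] measurable_sets[OF component_measurable[OF i, of \<tau>], of low] A
      by (simp_all add: sets_Gs_K vimage_def Int_def conj_commute)
    have P1: "M.prob {\<omega> \<in> space ?M. \<omega> i \<in> tail} \<le> e / 3"
      using component_law[OF i A(1), where \<tau> = \<tau>] tail_prob[OF C(2) tight, of "\<tau> i"] e by (simp add: tail_def)
    have P2: "M.prob {\<omega> \<in> space ?M. \<omega> i \<in> low} \<le> e / 3"
      using component_law[OF i A(2), where \<tau> = \<tau>] small_marg_dens_prob[OF C(2) A4_fin[OF C(1)] \<kappa>, of "\<tau> i"] \<kappa>C
      by (simp add: low_def)
    have int_d: "integrable ?M d"
      by (rule M.integrable_const_bound[of _ 2]) (use d0 d2 in auto)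
    have P3: "M.prob {\<omega> \<in> space ?M. s0 \<le> d \<omega>} \<le> e / 3"
    proof -
      have "M.prob {\<omega> \<in> space ?M. s0 \<le> d \<omega>} \<le> (\<integral>\<omega>. d \<omega> \<partial>?M) / s0"
        by (rule integral_Markov_inequality_measure[OF int_d, of "{}"]) (use d0 s0 in auto)
      also have "(\<integral>\<omega>. d \<omega> \<partial>?M) = risk m" unfolding d_def by (rule expected_dBL_others[OF i])
      also have "risk m / s0 \<le> e / 3" using risk s0 by (simp add: field_simps)
      finally show ?thesis .
    qed
    have "{\<omega> \<in> space ?M. \<delta> < \<bar>P \<omega> - R \<omega>\<bar>}
      \<subseteq> {\<omega> \<in> space ?M. \<omega> i \<in> tail} \<union> {\<omega> \<in> space ?M. \<omega> i \<in> low} \<union> {\<omega> \<in> space ?M. s0 \<le> d \<omega>}"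
    proof (rule ccontr)
      assume "\<not> ?thesis"
      then obtain \<omega> where "\<omega> \<in> space ?M" and \<delta>_less: "\<delta> < \<bar>P \<omega> - R \<omega>\<bar>"
        and "\<omega> i \<notin> tail" "\<omega> i \<notin> low" "\<not> s0 \<le> d \<omega>"
        by blast
      then have \<omega>: "\<delta> < \<bar>P \<omega> - R \<omega>\<bar>" "snd (\<omega> i) \<in> C" "\<kappa> \<le> marg_dens p Gs (snd (\<omega> i))" "d \<omega> < s0"
        by (auto simp: tail_def low_def)
      let ?H = "post_mean Prior p (others i \<omega>) m"
      have "\<kappa> * \<delta> < marg_dens p Gs (snd (\<omega> i)) * \<bar>P \<omega> - R \<omega>\<bar>"
        using \<omega> \<kappa> \<delta> by (intro mult_le_less_imp_less) auto
      also have "\<dots> \<le> (c * d \<omega> + \<kappa> * \<delta> / 4) + (c * d \<omega> + \<kappa> * \<delta> / 4)"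
        using Pmix_diff_le[OF subprob_space_post_mean sets_post_mean, of "snd (\<omega> i)" "others i \<omega>" m "fst (\<omega> i)"]
          c(2)[OF \<omega>(2) subprob_space_post_mean sets_post_mean, of "others i \<omega>" m "fst (\<omega> i)"]
        unfolding P_def R_def d_def pb_pval_eq_Pmix[OF i] by linarith
      also have "c * d \<omega> \<le> \<kappa> * \<delta> / 4"
        using mult_left_mono[of "d \<omega>" s0 c] \<omega>(4) c(1) cs0 by linarith
      finally show False by simp
    qed
    then have "M.prob {\<omega> \<in> space ?M. \<delta> < \<bar>P \<omega> - R \<omega>\<bar>}
      \<le> M.prob ({\<omega> \<in> space ?M. \<omega> i \<in> tail} \<union> {\<omega> \<in> space ?M. \<omega> i \<in> low} \<union> {\<omega> \<in> space ?M. s0 \<le> d \<omega>})"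
      by (rule M.finite_measure_mono) measurable
    also have "\<dots> \<le> M.prob {\<omega> \<in> space ?M. \<omega> i \<in> tail} + M.prob {\<omega> \<in> space ?M. \<omega> i \<in> low} + M.prob {\<omega> \<in> space ?M. s0 \<le> d \<omega>}"
      by (rule order_trans[OF measure_Un_le add_right_mono[OF measure_Un_le]]) measurable
    also have "\<dots> \<le> e" using P1 P2 P3 by linarith
    finally show "M.prob {\<omega> \<in> space ?M.
        \<delta> < \<bar>pb_pval Prior p Q (Suc m) i (fst (\<omega> i)) (\<lambda>j. snd (\<omega> j)) - Pmix Gs (fst (\<omega> i)) (snd (\<omega> i))\<bar>} \<le> e"
      by (simp add: P_def R_def)
  qed
qed

text \<open>Exact uniformity of the oracle means that perturbing the p-value by
  \<open>\<delta>\<close> costs a shift of \<open>\<delta>\<close> in the level, whatever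
  \<open>\<alpha>\<close> is. As \<open>s\<close> is chosen before \<open>m\<close>,
  \<open>\<tau>\<close>, \<open>i\<close> and \<open>\<alpha>\<close>, the bound holds for all
  nulls, levels and configurations together.\<close>

lemma pval_almost_uniform:
  assumes e: "0 < e"
  obtains s where "0 < s"
    "\<And>m \<tau> i \<alpha>. i < Suc m \<Longrightarrow> \<tau> i = \<theta>0 \<Longrightarrow> risk m < s \<Longrightarrow> 0 \<le> \<alpha> \<Longrightarrow> \<alpha> \<le> 1 \<Longrightarrow>
      \<bar>measure (data_law \<tau> (Suc m)) {\<omega> \<in> space (data_law \<tau> (Suc m)).
        pb_pval Prior p Q (Suc m) i (fst (\<omega> i)) (\<lambda>j. snd (\<omega> j)) \<le> \<alpha>} - \<alpha>\<bar> \<le> e"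
proof -
  \<comment> \<open>One half of \<open>e\<close> pays for the shift of the level, the other for the
    probability of a large deviation.\<close>
  define \<delta> where "\<delta> = e / 2"
  have \<delta>: "0 < \<delta>" "\<delta> + \<delta> = e" using e by (auto simp: \<delta>_def)
  obtain s where s: "0 < s" "\<And>m \<tau> i. i < Suc m \<Longrightarrow> risk m < s \<Longrightarrow>
      measure (data_law \<tau> (Suc m)) {\<omega> \<in> space (data_law \<tau> (Suc m)).
        \<delta> < \<bar>pb_pval Prior p Q (Suc m) i (fst (\<omega> i)) (\<lambda>j. snd (\<omega> j)) - Pmix Gs (fst (\<omega> i)) (snd (\<omega> i))\<bar>} \<le> \<delta>"
    by (rule pval_close_to_oracle[OF \<delta>(1) \<delta>(1)]) blast
  show ?thesis
  proof (rule that[OF s(1)])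
    fix m \<tau> i and \<alpha> :: real
    assume i: "i < Suc m" and \<tau>: "\<tau> i = \<theta>0" and risk: "risk m < s" and \<alpha>: "0 \<le> \<alpha>" "\<alpha> \<le> 1"
    let ?M = "data_law \<tau> (Suc m)"
    interpret M: prob_space ?M by (rule prob_space_data_law)
    define P where "P \<omega> = pb_pval Prior p Q (Suc m) i (fst (\<omega> i)) (\<lambda>j. snd (\<omega> j))" for \<omega> :: "nat \<Rightarrow> real \<times> 'u"
    define R where "R \<omega> = Pmix Gs (fst (\<omega> i)) (snd (\<omega> i))" for \<omega> :: "nat \<Rightarrow> real \<times> 'u"
    have [measurable]: "P \<in> borel_measurable ?M"
      unfolding P_def by (rule pval_measurable[OF i])
    have [measurable]: "R \<in> borel_measurable ?M"
      using measurable_compose[OF measurable_Pair[OF data_measurable(2)[OF i] data_measurable(1)[OF i]] Pmix_Gs_measurable]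
      by (simp add: R_def[abs_def])
    have R: "M.prob {\<omega> \<in> space ?M. R \<omega> \<le> b} = b" if "0 \<le> b" "b \<le> 1" for b
    proof -
      have "{z. Pmix Gs (fst z) (snd z) \<le> b} \<in> sets TU_space"
        by (rule sets_TU_Collect) measurable
      from component_law[OF i this, where \<tau> = \<tau>] oracle_uniform[OF that] show ?thesis
        by (simp add: \<tau> R_def)
    qed
    have bad: "M.prob {\<omega> \<in> space ?M. \<delta> < \<bar>P \<omega> - R \<omega>\<bar>} \<le> \<delta>"
      unfolding P_def R_def by (rule s(2)[OF i risk])
    have "M.prob {\<omega> \<in> space ?M. P \<omega> \<le> \<alpha>} \<le> \<alpha> + e"
    \<comment> \<open>The oracle is evaluated only at levels in \<open>[0, 1]\<close>; past 1, and
      below 0 in the lower bound, the trivial bounds on a probability suffice.\<close>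
    proof (cases "\<alpha> + \<delta> \<le> 1")
      case True
      have "M.prob {\<omega> \<in> space ?M. P \<omega> \<le> \<alpha>} \<le> M.prob ({\<omega> \<in> space ?M. R \<omega> \<le> \<alpha> + \<delta>} \<union> {\<omega> \<in> space ?M. \<delta> < \<bar>P \<omega> - R \<omega>\<bar>})"
        by (rule M.finite_measure_mono) (auto simp: abs_if split: if_splits)
      also have "\<dots> \<le> M.prob {\<omega> \<in> space ?M. R \<omega> \<le> \<alpha> + \<delta>} + M.prob {\<omega> \<in> space ?M. \<delta> < \<bar>P \<omega> - R \<omega>\<bar>}"
        by (rule measure_Un_le) measurable
      finally show ?thesis using R[of "\<alpha> + \<delta>"] bad True \<alpha> \<delta> by linarith
    next
      case False
      then show ?thesis using M.prob_le_1[of "{\<omega> \<in> space ?M. P \<omega> \<le> \<alpha>}"] \<delta> by linarith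
    qed
    moreover have "\<alpha> - e \<le> M.prob {\<omega> \<in> space ?M. P \<omega> \<le> \<alpha>}"
    proof (cases "\<delta> \<le> \<alpha>")
      case True
      have "M.prob {\<omega> \<in> space ?M. R \<omega> \<le> \<alpha> - \<delta>} \<le> M.prob ({\<omega> \<in> space ?M. P \<omega> \<le> \<alpha>} \<union> {\<omega> \<in> space ?M. \<delta> < \<bar>P \<omega> - R \<omega>\<bar>})"
        by (rule M.finite_measure_mono) (auto simp: abs_if split: if_splits)
      also have "\<dots> \<le> M.prob {\<omega> \<in> space ?M. P \<omega> \<le> \<alpha>} + M.prob {\<omega> \<in> space ?M. \<delta> < \<bar>P \<omega> - R \<omega>\<bar>}"
        by (rule measure_Un_le) measurable
      finally show ?thesis using R[of "\<alpha> - \<delta>"] bad True \<alpha> \<delta> by linarith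
    next
      case False
      then show ?thesis using \<delta> measure_nonneg[of ?M "{\<omega> \<in> space ?M. P \<omega> \<le> \<alpha>}"] by linarith
    qed
    ultimately show "\<bar>M.prob {\<omega> \<in> space ?M. pb_pval Prior p Q (Suc m) i (fst (\<omega> i)) (\<lambda>j. snd (\<omega> j)) \<le> \<alpha>} - \<alpha>\<bar> \<le> e"
      by (simp add: P_def abs_le_iff)
  qed
qed

end

section \<open>Reduction to a sigma-finite dominating measure\<close>

text \<open>Tightness makes all densities live on countably many compact sets, each of finite \<open>lam\<close>-measure;
  this is what Fubini's theorem needs.\<close>
lemma sigma_finite_restriction:
  fixes p :: "'u::topological_space \<Rightarrow> 'v \<Rightarrow> real"
  assumes lam_sets [measurable_cong]: "sets lam = sets (borel :: 'u measure)"
    and dens_meas [measurable]: "\<And>\<nu>. (\<lambda>u. p u \<nu>) \<in> borel_measurable lam"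
    and prob: "\<And>\<nu>. prob_space (density lam (\<lambda>u. ennreal (p u \<nu>)))"
    and tight: "\<forall>\<epsilon>>0. \<exists>C. compact C \<and> C \<in> sets (borel :: 'u measure) \<and>
                     (\<forall>\<nu>. measure (density lam (\<lambda>u. ennreal (p u \<nu>))) (UNIV - C) < \<epsilon>)"
    and fin: "\<And>C. compact C \<Longrightarrow> emeasure lam C < \<infinity>"
  obtains lam' where "sigma_finite_measure lam'" "sets lam' = sets (borel :: 'u measure)"
    "\<And>\<nu>. density lam' (\<lambda>u. ennreal (p u \<nu>)) = density lam (\<lambda>u. ennreal (p u \<nu>))"
    "\<And>C. compact C \<Longrightarrow> emeasure lam' C < \<infinity>"
proof -
  have space_lam: "space lam = UNIV" using sets_eq_imp_space_eq[OF lam_sets] by simp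
  have "\<exists>C. compact C \<and> C \<in> sets (borel :: 'u measure) \<and>
      (\<forall>\<nu>. measure (density lam (\<lambda>u. ennreal (p u \<nu>))) (UNIV - C) < 1 / real (Suc k))" for k
    using tight by simp
  then obtain C :: "nat \<Rightarrow> 'u set" where C: "\<And>k. compact (C k)" "\<And>k. C k \<in> sets borel"
    "\<And>k \<nu>. measure (density lam (\<lambda>u. ennreal (p u \<nu>))) (UNIV - C k) < 1 / real (Suc k)"
    by metis
  define S where "S = (\<Union>k. C k)"
  have S [measurable]: "S \<in> sets borel" using C(2) by (auto simp: S_def)
  define lam' where "lam' = density lam (indicator S)"
  have em: "emeasure lam' A = emeasure lam (S \<inter> A)" if "A \<in> sets borel" for A
  proof -
    have "emeasure lam' A = (\<integral>\<^sup>+u. indicator S u * indicator A u \<partial>lam)"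
      unfolding lam'_def using that by (intro emeasure_density) (simp_all add: lam_sets)
    also have "\<dots> = (\<integral>\<^sup>+u. indicator (S \<inter> A) u \<partial>lam)"
      by (simp add: indicator_inter_arith)
    also have "\<dots> = emeasure lam (S \<inter> A)"
      using S that by (intro nn_integral_indicator) (simp add: lam_sets)
    finally show ?thesis .
  qed
  have le: "emeasure lam' A \<le> emeasure lam A" for A
  proof (cases "A \<in> sets borel")
    case True
    then show ?thesis by (simp add: em) (rule emeasure_mono, auto simp: lam_sets)
  next
    case False
    then show ?thesis by (simp add: emeasure_notin_sets lam'_def lam_sets)
  qed
  have "sigma_finite_measure lam'"
  proof
    show "\<exists>A. countable A \<and> A \<subseteq> sets lam' \<and> \<Union> A = space lam' \<and> (\<forall>a\<in>A. emeasure lam' a \<noteq> \<infinity>)"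
    proof (intro exI conjI ballI)
      \<comment> \<open>The complement of \<open>S\<close> is null for \<open>lam'\<close>, so it
        can complete the compact sets to a cover of the whole space.\<close>
      show "countable (insert (UNIV - S) (range C))" by simp
      show "insert (UNIV - S) (range C) \<subseteq> sets lam'"
        using C(2) S by (auto simp: lam'_def lam_sets)
      show "\<Union> (insert (UNIV - S) (range C)) = space lam'" by (auto simp: lam'_def space_lam S_def)
      fix a assume "a \<in> insert (UNIV - S) (range C)"
      then consider "a = UNIV - S" | k where "a = C k" by auto
      then show "emeasure lam' a \<noteq> \<infinity>"
      proof cases
        case 1
        then show ?thesis using S by (simp add: em borel_comp Compl_eq_Diff_UNIV[symmetric])
      next
        case 2
        have "emeasure lam' (C k) < \<infinity>" by (rule le_less_trans[OF le fin[OF C(1)]])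
        then show ?thesis using 2 by simp
      qed
    qed
  qed
  moreover have "density lam' (\<lambda>u. ennreal (p u \<nu>)) = density lam (\<lambda>u. ennreal (p u \<nu>))" for \<nu>
  proof -
    let ?D = "density lam (\<lambda>u. ennreal (p u \<nu>))"
    interpret prob_space ?D by (rule prob)
    \<comment> \<open>\<open>UNIV - S\<close> lies in every \<open>UNIV - C k\<close>, so tightness
      along \<open>1 / Suc k\<close> makes it null for each density law; hence the density vanishes
      almost everywhere off \<open>S\<close>.\<close>
    have "measure ?D (UNIV - S) \<le> e" if "0 < e" for e
    proof -
      obtain k where k: "1 / real (Suc k) < e" using \<open>0 < e\<close> by (rule nat_approx_posE)
      have "measure ?D (UNIV - S) \<le> measure ?D (UNIV - C k)"
        using C(2)[of k] by (intro finite_measure_mono) (auto simp: S_def lam_sets)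
      then show ?thesis using C(3)[of \<nu> k] k by linarith
    qed
    then have "measure ?D (UNIV - S) \<le> 0" by (rule field_le_epsilon) (simp only: add_0)
    then have "emeasure ?D (UNIV - S) = 0"
      by (simp add: emeasure_eq_measure measure_le_0_iff)
    then have "UNIV - S \<in> null_sets ?D" using S by (simp add: null_sets_def lam_sets)
    then have "AE u in ?D. u \<notin> UNIV - S" by (rule AE_not_in)
    then have "AE u in lam. 0 < ennreal (p u \<nu>) \<longrightarrow> u \<in> S"
      by (subst (asm) AE_density) auto
    then have "AE u in lam. indicator S u * ennreal (p u \<nu>) = ennreal (p u \<nu>)"
      by (rule AE_mp) (auto intro!: AE_I2 split: split_indicator simp: not_less ennreal_neg)
    then show ?thesis
      unfolding lam'_def by (subst density_density_eq) (auto intro!: density_cong)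
  qed
  ultimately show ?thesis
    using that[of lam'] le_less_trans[OF le fin] by (simp add: lam'_def lam_sets)
qed

section \<open>Asymptotic uniformity\<close>

theorem theorem3:
  fixes K :: "'t \<Rightarrow> 'v::metric_space \<Rightarrow> (real \<times> 'u::topological_space) measure"
    and Q :: "'v \<Rightarrow> 'u \<Rightarrow> real measure"
    and p :: "'u \<Rightarrow> 'v \<Rightarrow> real"
    and lam :: "'u measure"
    and Prior :: "'v measure measure"
    and Gs :: "'v measure"
    and \<theta> :: "nat \<Rightarrow> nat \<Rightarrow> 't"
    and \<theta>0 :: 't
  assumes kernel: "\<And>\<theta>'. K \<theta>' \<in> borel \<rightarrow>\<^sub>M prob_algebra TU_space"
    and lam_sets: "sets lam = sets (borel :: 'u measure)"
    and dens_meas: "\<And>\<nu>. (\<lambda>u. p u \<nu>) \<in> borel_measurable lam"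
    and dens_nonneg: "\<And>u \<nu>. 0 \<le> p u \<nu>"
    and U_law: "\<And>\<theta>' \<nu>. distr (K \<theta>' \<nu>) (borel :: 'u measure) snd = density lam (\<lambda>u. ennreal (p u \<nu>))"
    and Q_kernel: "\<And>\<nu>. Q \<nu> \<in> lam \<rightarrow>\<^sub>M prob_algebra (borel :: real measure)"
    and disint: "\<And>\<nu>. K \<theta>0 \<nu> = density lam (\<lambda>u. ennreal (p u \<nu>)) \<bind> (\<lambda>u. distr (Q \<nu> u) TU_space (\<lambda>t. (t, u)))"
    and A1: "\<And>\<nu> u. absolutely_continuous lborel (Q \<nu> u)"
    and A2: "compact (UNIV :: 'v set)"
    and A3: "\<forall>\<epsilon>>0. \<exists>\<delta>>0. \<forall>t u \<nu> \<nu>'. dist \<nu> \<nu>' < \<delta> \<longrightarrow> \<bar>Por Q t u \<nu> - Por Q t u \<nu>'\<bar> < \<epsilon>"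
    and A4_tight: "\<forall>\<epsilon>>0. \<exists>C. compact C \<and> C \<in> sets (borel :: 'u measure) \<and>
                     (\<forall>\<nu>. measure (density lam (\<lambda>u. ennreal (p u \<nu>))) (UNIV - C) < \<epsilon>)"
    and A4_fin: "\<And>C. compact C \<Longrightarrow> emeasure lam C < \<infinity>"
    and A4_bdd: "\<And>C. compact C \<Longrightarrow> \<exists>B. \<forall>u\<in>C. \<forall>\<nu>. \<bar>p u \<nu>\<bar> \<le> B"
    and A4_equi: "\<And>C. compact C \<Longrightarrow> \<forall>\<epsilon>>0. \<exists>\<delta>>0. \<forall>u\<in>C. \<forall>\<nu> \<nu>'. dist \<nu> \<nu>' < \<delta> \<longrightarrow> \<bar>p u \<nu> - p u \<nu>'\<bar> < \<epsilon>"
    and prior: "prob_space Prior" "sets Prior = sets (prob_algebra (borel :: 'v measure))"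
    and Gs: "prob_space Gs" "sets Gs = sets (borel :: 'v measure)"
    and post_consistent:
      "(\<lambda>n. \<integral>us. dBL (post_mean Prior p us n) Gs
              \<partial>(PiM {..<n} (\<lambda>_. Gs \<bind> (\<lambda>\<nu>. density lam (\<lambda>u. ennreal (p u \<nu>)))))) \<longlonglongrightarrow> 0"
  shows "limsup (\<lambda>n. ereal (SUP \<alpha>\<in>{0..1::real}. Max ({0} \<union>
            (\<lambda>i. \<bar>measure (PiM {..<n} (\<lambda>j. Gs \<bind> K (\<theta> n j)))
                     {\<omega> \<in> space (PiM {..<n} (\<lambda>j. Gs \<bind> K (\<theta> n j))).
                        pb_pval Prior p Q n i (fst (\<omega> i)) (\<lambda>j. snd (\<omega> j)) \<le> \<alpha>} - \<alpha>\<bar>)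
            ` {i. i < n \<and> \<theta> n i = \<theta>0}))) = 0"
proof -
  have TU_snd: "snd \<in> (TU_space :: (real \<times> 'u) measure) \<rightarrow>\<^sub>M borel" by (simp add: TU_space_def)
  have prob_density: "prob_space (density lam (\<lambda>u. ennreal (p u \<nu>)))" for \<nu>
    using measurable_space[OF measurable_compose[OF kernel measurable_distr_prob_space[OF TU_snd]], of \<nu>]
    by (simp add: U_law space_prob_algebra)
  obtain lam' where lam': "sigma_finite_measure lam'" "sets lam' = sets (borel :: 'u measure)"
    "\<And>\<nu>. density lam' (\<lambda>u. ennreal (p u \<nu>)) = density lam (\<lambda>u. ennreal (p u \<nu>))"
    "\<And>C. compact C \<Longrightarrow> emeasure lam' C < \<infinity>"
    by (rule sigma_finite_restriction[OF lam_sets dens_meas prob_density A4_tight A4_fin]) blast+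
  have lam'_lam: "sets lam' = sets lam" using lam'(2) lam_sets by simp
  have lam'_dens_meas: "(\<lambda>u. p u \<nu>) \<in> borel_measurable lam'" for \<nu>
    using dens_meas by (simp add: measurable_cong_sets[OF lam'_lam refl])
  have lam'_Q_kernel: "Q \<nu> \<in> lam' \<rightarrow>\<^sub>M prob_algebra borel" for \<nu>
    using Q_kernel by (simp add: measurable_cong_sets[OF lam'_lam refl])
  \<comment> \<open>The kernel, its disintegration and tightness see \<open>lam\<close> only through
    the density laws, which \<open>lam'\<close> reproduces, and the measurability conditions only
    through its sigma-algebra. The p-value and the posterior mean do not mention it.\<close>
  interpret partially_bayes_model K Q p lam' Prior Gs \<theta>0
    by (rule partially_bayes_model.intro)
       (erule lam'(4) A4_bdd A4_equi
         | rule kernel lam'(2,1) lam'_dens_meas dens_nonneg U_law[folded lam'(3)] lam'_Q_kernel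
           disint[folded lam'(3)] A1 A2 A3 A4_tight[folded lam'(3)] prior Gs)+
  have risk: "risk \<longlonglongrightarrow> 0"
    using post_consistent by (simp add: risk_def[abs_def] U_mix_def lam'(3))
  define err where "err n \<alpha> = Max ({0} \<union>
            (\<lambda>i. \<bar>measure (PiM {..<n} (\<lambda>j. Gs \<bind> K (\<theta> n j)))
                     {\<omega> \<in> space (PiM {..<n} (\<lambda>j. Gs \<bind> K (\<theta> n j))).
                        pb_pval Prior p Q n i (fst (\<omega> i)) (\<lambda>j. snd (\<omega> j)) \<le> \<alpha>} - \<alpha>\<bar>)
            ` {i. i < n \<and> \<theta> n i = \<theta>0})" for n and \<alpha> :: real
  have "(\<lambda>n. SUP \<alpha>\<in>{0..1}. err n \<alpha>) \<longlonglongrightarrow> 0"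
  proof (rule LIMSEQ_I)
    fix r :: real assume "0 < r"
    then have "0 < r / 2" by simp
    then obtain s where s: "0 < s"
      "\<And>m \<tau> i \<alpha>. i < Suc m \<Longrightarrow> \<tau> i = \<theta>0 \<Longrightarrow> risk m < s \<Longrightarrow> 0 \<le> \<alpha> \<Longrightarrow> \<alpha> \<le> 1 \<Longrightarrow>
      \<bar>measure (data_law \<tau> (Suc m)) {\<omega> \<in> space (data_law \<tau> (Suc m)).
        pb_pval Prior p Q (Suc m) i (fst (\<omega> i)) (\<lambda>j. snd (\<omega> j)) \<le> \<alpha>} - \<alpha>\<bar> \<le> r / 2"
      by (rule pval_almost_uniform) blast
    from risk s(1) have "eventually (\<lambda>m. risk m < s) sequentially"
      by (auto simp: order_tendsto_iff)
    then obtain N where N: "\<And>m. N \<le> m \<Longrightarrow> risk m < s"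
      by (auto simp: eventually_sequentially)
    \<comment> \<open>\<open>Suc N\<close> rather than \<open>N\<close>, because a sample of size
      \<open>Suc m\<close> is controlled by \<open>risk m\<close>.\<close>
    have "norm ((SUP \<alpha>\<in>{0..1}. err n \<alpha>) - 0) < r" if n: "Suc N \<le> n" for n
    proof -
      obtain m where m: "n = Suc m" "N \<le> m" using n by (cases n) auto
      have le: "err n \<alpha> \<le> r / 2" if "\<alpha> \<in> {0..1}" for \<alpha>
        unfolding err_def using s(2)[of _ m "\<theta> n" \<alpha>] N[OF m(2)] that \<open>0 < r\<close>
        by (subst Max_le_iff) (auto simp: m(1) data_law_def)
      have ge: "0 \<le> err n \<alpha>" for \<alpha>
        unfolding err_def by (rule Max_ge) auto
      have "(SUP \<alpha>\<in>{0..1}. err n \<alpha>) \<le> r / 2"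
        using le by (intro cSUP_least) auto
      moreover have "err n 0 \<le> (SUP \<alpha>\<in>{0..1}. err n \<alpha>)"
        by (rule cSUP_upper) (use le in \<open>auto intro!: bdd_aboveI[of _ "r / 2"]\<close>)
      ultimately show ?thesis using ge[of 0] \<open>0 < r\<close> by simp
    qed
    then show "\<exists>N. \<forall>n\<ge>N. norm ((SUP \<alpha>\<in>{0..1}. err n \<alpha>) - 0) < r" by blast
  qed
  then have "(\<lambda>n. ereal (SUP \<alpha>\<in>{0..1}. err n \<alpha>)) \<longlonglongrightarrow> ereal 0"
    by (rule tendsto_ereal)
  then have "limsup (\<lambda>n. ereal (SUP \<alpha>\<in>{0..1}. err n \<alpha>)) = ereal 0"
    by (rule lim_imp_Limsup[OF sequentially_bot])
  then show ?thesis by (simp add: err_def zero_ereal_def)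
qed

end
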